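(* For every $n\ge1$, the number of domino tilings of the Aztec diamond $AD_n$ equals $\det M_H$, where $M_H$ is the hamburger matrix of the digraph $H$ of $AD_n$.
   Context: The Aztec diamond $AD_n$ is the union of the $2n(n+1)$ unit squares in the plane whose vertices are integral points $(x,y)$ with $|x|+|y|\le n+1$. A domino tiling is a tiling by $1\times2$ and $2\times1$ rectangles made of two unit squares. Digraph of $AD_n$: tile $AD_n$ by horizontal dominoes (the natural tiling; each row of even length is cut into horizontal dominoes) and put a vertex at the center of each domino. From every vertex $(x,y)$ in the top half ($y>0$), create directed edges to $(x+2,y)$, $(x+1,y+1)$, $(x+1,y-1)$ whenever there is a vertex there. From every vertex in the bottom half ($y<0$), create directed edges to $(x-2,y)$, $(x-1,y-1)$, $(x-1,y+1)$ whenever there is a vertex there. Label the vertices of the bottom row of the top half $v_1,\dots,v_n$ from west to east, and the vertices of the top row of the bottom half $w_{n+1},\dots,w_{2n}$ from west to east. For each $1\le i\le n$ add directed edges $v_i\to w_{n+i}$ and $w_{n+i}\to v_i$. Let $G_1$ and $G_2$ be the subgraphs on the top-half and bottom-half vertices, respectively. The hamburger matrix of $H$ is the $2n\times2n$ block matrix $M_H=\begin{bmatrix}A&I_n\\-I_n&B\end{bmatrix}$, where $a_{ij}$ is the number of directed paths from $v_i$ to $v_j$ in $G_1$ and $b_{ij}$ is the number of directed paths from $w_{n+i}$ to $w_{n+j}$ in $G_2$ (trivial paths counted, so $a_{ii}=b_{ii}=1$). *)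

theory Defs
  imports
    "HOL-Library.Disjoint_Sets"
    "Graph_Theory.Digraph_Component"
    "Jordan_Normal_Form.Determinant"
begin

section \<open>Domino tilings of the Aztec diamond\<close>

text \<open>A unit square with integral vertices is represented by its lower left vertex, and a region
  of the plane made of such squares by the set of its squares.\<close>

type_synonym cell = "int \<times> int"

definition aztec_diamond :: "nat \<Rightarrow> cell set" where
  "aztec_diamond n = {(a, b). \<forall>x\<in>{a, a + 1}. \<forall>y\<in>{b, b + 1}. \<bar>x\<bar> + \<bar>y\<bar> \<le> int n + 1}"

definition horizontal_domino :: "cell set \<Rightarrow> bool" where
  "horizontal_domino d \<longleftrightarrow> (\<exists>a b. d = {(a, b), (a + 1, b)})"

definition vertical_domino :: "cell set \<Rightarrow> bool" where
  "vertical_domino d \<longleftrightarrow> (\<exists>a b. d = {(a, b), (a, b + 1)})"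

definition domino_tilings :: "cell set \<Rightarrow> cell set set set" where
  "domino_tilings R =
     {T. partition_on R T \<and> (\<forall>d\<in>T. horizontal_domino d \<or> vertical_domino d)}"


section \<open>The digraph of the Aztec diamond\<close>

text \<open>Each row is cut into horizontal dominoes starting from its west end: the left square of a
  domino has an even number of squares of its row to the west. By \<open>natural_tiling_unique\<close> below,
  this is the only tiling by horizontal dominoes.\<close>

definition natural_tiling :: "nat \<Rightarrow> cell set set" where
  "natural_tiling n = {{(a, b), (a + 1, b)} | a b.
     (a, b) \<in> aztec_diamond n \<and> even (card {a'. a' < a \<and> (a', b) \<in> aztec_diamond n})}"

text \<open>The center of a domino is the midpoint of the centers of its two squares.\<close>

definition domino_center :: "cell set \<Rightarrow> real \<times> real" where
  "domino_center d =
     ((\<Sum>(a, b)\<in>d. of_int a + 1/2) / 2, (\<Sum>(a, b)\<in>d. of_int b + 1/2) / 2)"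

definition aztec_verts :: "nat \<Rightarrow> (real \<times> real) set" where
  "aztec_verts n = domino_center ` natural_tiling n"

text \<open>The rows next to the \<open>x\<close>-axis, at heights \<open>1/2\<close> and \<open>-1/2\<close>, labelled from west to east:
  \<open>v\<^sub>1, \<dots>, v\<^sub>n\<close> and \<open>w\<^sub>n\<^sub>+\<^sub>1, \<dots>, w\<^sub>2\<^sub>n\<close>. See \<open>aztec_v_row\<close> and
  \<open>aztec_w_row\<close> below.\<close>

definition aztec_v :: "nat \<Rightarrow> nat \<Rightarrow> real \<times> real" where
  "aztec_v n i = (2 * real i - real n - 1, 1/2)"

definition aztec_w :: "nat \<Rightarrow> nat \<Rightarrow> real \<times> real" where
  "aztec_w n k = (2 * (real k - real n) - real n - 1, - 1/2)"

definition aztec_arcs :: "nat \<Rightarrow> (real \<times> real) rel" where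
  "aztec_arcs n =
     {((x, y), q) | x y q. (x, y) \<in> aztec_verts n \<and> q \<in> aztec_verts n \<and> y > 0 \<and>
        q \<in> {(x + 2, y), (x + 1, y + 1), (x + 1, y - 1)}} \<union>
     {((x, y), q) | x y q. (x, y) \<in> aztec_verts n \<and> q \<in> aztec_verts n \<and> y < 0 \<and>
        q \<in> {(x - 2, y), (x - 1, y - 1), (x - 1, y + 1)}} \<union>
     (\<Union>i\<in>{1..n}. {(aztec_v n i, aztec_w n (n + i)), (aztec_w n (n + i), aztec_v n i)})"

definition aztec_digraph :: "nat \<Rightarrow> (real \<times> real) pair_pre_digraph" where
  "aztec_digraph n = \<lparr>pverts = aztec_verts n, parcs = aztec_arcs n\<rparr>"

definition aztec_upper :: "nat \<Rightarrow> (real \<times> real, (real \<times> real) \<times> (real \<times> real)) pre_digraph" where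
  "aztec_upper n = with_proj (aztec_digraph n) \<restriction> {(x, y) \<in> aztec_verts n. y > 0}"

definition aztec_lower :: "nat \<Rightarrow> (real \<times> real, (real \<times> real) \<times> (real \<times> real)) pre_digraph" where
  "aztec_lower n = with_proj (aztec_digraph n) \<restriction> {(x, y) \<in> aztec_verts n. y < 0}"


section \<open>The hamburger matrix\<close>

definition path_count :: "('a, 'b) pre_digraph \<Rightarrow> 'a \<Rightarrow> 'a \<Rightarrow> nat" where
  "path_count G u u' = card {p. pre_digraph.apath G u p u'}"

text \<open>Matrix indices start at \<open>0\<close>, vertex labels at \<open>1\<close> for \<open>v\<close> and at \<open>n + 1\<close> for \<open>w\<close>.\<close>

definition hamburger_matrix ::
    "nat \<Rightarrow> ('a, 'b) pre_digraph \<Rightarrow> ('a, 'b) pre_digraph \<Rightarrow> (nat \<Rightarrow> 'a) \<Rightarrow> (nat \<Rightarrow> 'a) \<Rightarrow> int mat" where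
  "hamburger_matrix n G1 G2 v w = four_block_mat
     (mat n n (\<lambda>(i, j). int (path_count G1 (v (i + 1)) (v (j + 1)))))
     (1\<^sub>m n)
     (- 1\<^sub>m n)
     (mat n n (\<lambda>(i, j). int (path_count G2 (w (n + i + 1)) (w (n + j + 1)))))"

definition aztec_hamburger_matrix :: "nat \<Rightarrow> int mat" where
  "aztec_hamburger_matrix n =
     hamburger_matrix n (aztec_upper n) (aztec_lower n) (aztec_v n) (aztec_w n)"


section \<open>Consistency of the definitions\<close>

definition aztec_row :: "nat \<Rightarrow> int \<Rightarrow> int" where
  "aztec_row n b = (if b \<ge> 0 then int n - b else int n + 1 + b)"

lemma mem_aztec_diamond: "(a, b) \<in> aztec_diamond n \<longleftrightarrow> - aztec_row n b \<le> a \<and> a < aztec_row n b"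
  unfolding aztec_diamond_def aztec_row_def by auto

lemma finite_aztec_diamond: "finite (aztec_diamond n)"
proof (rule finite_subset)
  show "aztec_diamond n \<subseteq> {- int n - 1..int n + 1} \<times> {- int n - 1..int n + 1}"
    unfolding aztec_diamond_def by auto
qed auto


lemma card_aztec_diamond: "card (aztec_diamond n) = 2 * n * (n + 1)"
proof -
  let ?S = "\<lambda>B. prod.swap ` (SIGMA b:B. {- aztec_row n b..<aztec_row n b})"
  let ?U = "int ` {..<n}" and ?L = "(\<lambda>k. - 1 - int k) ` {..<n}"
  have card: "card (?S B) = (\<Sum>b\<in>B. nat (2 * aztec_row n b))" if "finite B" for B
    using that by (subst card_image) (auto simp: card_SigmaI)
  have upper: "b \<in> ?U \<longleftrightarrow> 0 \<le> b \<and> b < int n" for b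
    by (auto simp: image_iff intro!: bexI[of _ "nat b"])
  have lower: "b \<in> ?L \<longleftrightarrow> - int n \<le> b \<and> b < 0" for b
    by (auto simp: image_iff intro!: bexI[of _ "nat (- 1 - b)"])
  have "(a, b) \<in> aztec_diamond n \<longleftrightarrow> (a, b) \<in> ?S (?U \<union> ?L)" for a b
  proof -
    have "(a, b) \<in> ?S (?U \<union> ?L) \<longleftrightarrow>
        (b \<in> ?U \<or> b \<in> ?L) \<and> - aztec_row n b \<le> a \<and> a < aztec_row n b"
      by (auto simp: image_iff)
    then show ?thesis
      unfolding upper lower mem_aztec_diamond by (auto simp: aztec_row_def split: if_splits)
  qed
  then have "aztec_diamond n = ?S (?U \<union> ?L)" by auto
  then have "card (aztec_diamond n) = (\<Sum>b\<in>?U \<union> ?L. nat (2 * aztec_row n b))"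
    using card[of "?U \<union> ?L"] by simp
  also have "\<dots> = (\<Sum>b\<in>?U. nat (2 * aztec_row n b)) + (\<Sum>b\<in>?L. nat (2 * aztec_row n b))"
    by (rule sum.union_disjoint) auto
  also have "(\<Sum>b\<in>?U. nat (2 * aztec_row n b)) = (\<Sum>k<n. 2 * (n - k))"
    by (subst sum.reindex) (auto simp: inj_on_def aztec_row_def intro!: sum.cong)
  also have "(\<Sum>b\<in>?L. nat (2 * aztec_row n b)) = (\<Sum>k<n. 2 * (n - k))"
    by (subst sum.reindex) (auto simp: inj_on_def aztec_row_def intro!: sum.cong)
  also have "(\<Sum>k<n. 2 * (n - k)) = n * (n + 1)"
  proof -
    have "(\<Sum>k<n. 2 * (n - k)) = (\<Sum>k<n. 2 * Suc k)"
      by (subst sum.nat_diff_reindex[symmetric]) (auto intro!: sum.cong)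
    also have "\<dots> = n * (n + 1)" by (induction n) auto
    finally show ?thesis .
  qed
  finally show ?thesis by simp
qed

lemma finite_domino_tilings: "finite (domino_tilings (aztec_diamond n))"
  by (rule finite_subset[of _ "Pow (Pow (aztec_diamond n))"])
    (auto simp: domino_tilings_def partition_on_def finite_aztec_diamond)

lemma natural_tiling_alt:
  "natural_tiling n = {{(a, b), (a + 1, b)} | a b.
     - aztec_row n b \<le> a \<and> a < aztec_row n b \<and> even (a + aztec_row n b)}"
proof -
  have "card {a'. a' < a \<and> (a', b) \<in> aztec_diamond n} = nat (a + aztec_row n b)"
    if "(a, b) \<in> aztec_diamond n" for a b
  proof -
    have "{a'. a' < a \<and> (a', b) \<in> aztec_diamond n} = {- aztec_row n b..<a}"
      using that by (auto simp: mem_aztec_diamond)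
    then show ?thesis by simp
  qed
  moreover have "even (nat (a + aztec_row n b)) \<longleftrightarrow> even (a + aztec_row n b)"
    if "(a, b) \<in> aztec_diamond n" for a b
    using that by (simp add: mem_aztec_diamond even_nat_iff)
  ultimately show ?thesis
    unfolding natural_tiling_def by (simp add: mem_aztec_diamond cong: conj_cong)
qed

lemma natural_tiling: "natural_tiling n \<in> domino_tilings (aztec_diamond n)"
  and natural_tiling_horizontal: "\<forall>d\<in>natural_tiling n. horizontal_domino d"
proof -
  have "\<Union> (natural_tiling n) = aztec_diamond n"
  proof (intro equalityI subsetI)
    fix c assume "c \<in> \<Union> (natural_tiling n)"
    then obtain a b where ab: "c \<in> {(a, b), (a + 1, b)}" "- aztec_row n b \<le> a"
        "a < aztec_row n b" "even (a + aztec_row n b)"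
      unfolding natural_tiling_alt by blast
    have "a + 1 \<noteq> aztec_row n b"
    proof
      assume "a + 1 = aztec_row n b"
      then have "a + aztec_row n b = 2 * a + 1" by simp
      then show False using ab(4) by simp
    qed
    then have "a + 1 < aztec_row n b" using ab(3) by linarith
    then show "c \<in> aztec_diamond n" using ab(1,2) by (auto simp: mem_aztec_diamond)
  next
    fix c assume c: "c \<in> aztec_diamond n"
    obtain a b where [simp]: "c = (a, b)" by (cases c)
    have ab: "- aztec_row n b \<le> a" "a < aztec_row n b" using c by (auto simp: mem_aztec_diamond)
    show "c \<in> \<Union> (natural_tiling n)"
    proof (cases "even (a + aztec_row n b)")
      case True
      then have "{(a, b), (a + 1, b)} \<in> natural_tiling n"
        unfolding natural_tiling_alt using ab by blast
      then show ?thesis by (rule UnionI) simp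
    next
      case False
      have "a \<noteq> - aztec_row n b"
      proof
        assume "a = - aztec_row n b"
        then have "a + aztec_row n b = 0" by simp
        then show False using False by simp
      qed
      then have "- aztec_row n b \<le> a - 1" "a - 1 < aztec_row n b" using ab by linarith+
      moreover have "even ((a - 1) + aztec_row n b)"
      proof -
        have "(a - 1) + aztec_row n b = (a + aztec_row n b) - 1" by simp
        then show ?thesis using False by (simp only: even_diff odd_one) simp
      qed
      ultimately have "{(a - 1, b), (a - 1 + 1, b)} \<in> natural_tiling n"
        unfolding natural_tiling_alt by blast
      then show ?thesis by (rule UnionI) simp
    qed
  qed
  moreover have "disjoint (natural_tiling n)"
  proof (rule disjointI)
    fix d d' assume "d \<in> natural_tiling n" "d' \<in> natural_tiling n" and ne: "d \<noteq> d'"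
    then obtain a b a' b' where d: "d = {(a, b), (a + 1, b)}" "d' = {(a', b'), (a' + 1, b')}"
        "even (a + aztec_row n b)" "even (a' + aztec_row n b')"
      unfolding natural_tiling_alt by blast
    show "d \<inter> d' = {}"
    proof (rule ccontr)
      assume "d \<inter> d' \<noteq> {}"
      then have "b = b'" "a = a' \<or> a = a' + 1 \<or> a' = a + 1" using d(1,2) by auto
      have "a \<noteq> a' + 1" "a' \<noteq> a + 1" using d(3,4) \<open>b = b'\<close> by auto
      then have "a = a'" using \<open>a = a' \<or> a = a' + 1 \<or> a' = a + 1\<close> by blast
      then show False using ne d(1,2) \<open>b = b'\<close> by simp
    qed
  qed
  moreover have "{} \<notin> natural_tiling n" unfolding natural_tiling_def by blast
  moreover show "\<forall>d\<in>natural_tiling n. horizontal_domino d"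
    unfolding natural_tiling_def horizontal_domino_def by blast
  ultimately show "natural_tiling n \<in> domino_tilings (aztec_diamond n)"
    unfolding domino_tilings_def partition_on_def by blast
qed

lemma natural_tiling_unique:
  assumes T: "T \<in> domino_tilings (aztec_diamond n)" and hor: "\<forall>d\<in>T. horizontal_domino d"
  shows "T = natural_tiling n"
proof -
  have part: "partition_on (aztec_diamond n) T" using T by (simp add: domino_tilings_def)
  have cover: "\<exists>d\<in>T. c \<in> d" if "c \<in> aztec_diamond n" for c
    using part that by (auto simp: partition_on_def)
  have inside: "c \<in> aztec_diamond n" if "c \<in> d" "d \<in> T" for c d
    using part that by (auto simp: partition_on_def)
  have disj: "d = d'" if "d \<in> T" "d' \<in> T" "c \<in> d" "c \<in> d'" for c d d'
    using part that by (auto simp: partition_on_def disjoint_def)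
  have row: "{(- aztec_row n b + 2 * int k, b), (- aztec_row n b + 2 * int k + 1, b)} \<in> T"
    if "- aztec_row n b + 2 * int k < aztec_row n b" for b k
    using that
  proof (induction k)
    case 0
    let ?a = "- aztec_row n b"
    have "(?a, b) \<in> aztec_diamond n" using 0 by (simp add: mem_aztec_diamond)
    then obtain d where d: "d \<in> T" "(?a, b) \<in> d" using cover by blast
    obtain a' b' where d': "d = {(a', b'), (a' + 1, b')}"
      using hor d unfolding horizontal_domino_def by blast
    have "(a', b') \<in> aztec_diamond n" using inside[of _ d] d d' by blast
    then have "a' = ?a" "b' = b" using d d' by (auto simp: mem_aztec_diamond)
    then show ?case using d d' by simp
  next
    case (Suc k)
    let ?a = "- aztec_row n b + 2 * int (Suc k)"
    have prev: "{(?a - 2, b), (?a - 1, b)} \<in> T"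
    proof -
      have "{(- aztec_row n b + 2 * int k, b), (- aztec_row n b + 2 * int k + 1, b)} \<in> T"
        using Suc by simp
      then show ?thesis by (simp add: algebra_simps)
    qed
    have "(?a, b) \<in> aztec_diamond n" using Suc.prems by (simp add: mem_aztec_diamond)
    then obtain d where d: "d \<in> T" "(?a, b) \<in> d" using cover by blast
    obtain a' b' where d': "d = {(a', b'), (a' + 1, b')}"
      using hor d unfolding horizontal_domino_def by blast
    have "\<not> (a' + 1 = ?a \<and> b' = b)"
    proof
      assume *: "a' + 1 = ?a \<and> b' = b"
      then have "(?a - 1, b) \<in> d" using d' by auto
      then have "d = {(?a - 2, b), (?a - 1, b)}" using disj[OF d(1) prev] by blast
      then show False using d(2) by auto
    qed
    then have "a' = ?a" "b' = b" using d d' by auto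
    then show ?case using d d' by simp
  qed
  have sub: "natural_tiling n \<subseteq> T"
  proof
    fix d assume "d \<in> natural_tiling n"
    then obtain a b where ab: "d = {(a, b), (a + 1, b)}" "- aztec_row n b \<le> a"
        "a < aztec_row n b" "even (a + aztec_row n b)"
      unfolding natural_tiling_alt by blast
    define k where "k = nat ((a + aztec_row n b) div 2)"
    have "a = - aztec_row n b + 2 * int k" using ab unfolding k_def by auto
    then show "d \<in> T" using row[of b k] ab by simp
  qed
  moreover have "T \<subseteq> natural_tiling n"
  proof
    fix d assume d: "d \<in> T"
    then have "d \<noteq> {}" using part by (auto simp: partition_on_def)
    then obtain c where c: "c \<in> d" by blast
    then have "c \<in> \<Union> (natural_tiling n)"
      using inside d natural_tiling[of n] by (auto simp: domino_tilings_def partition_on_def)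
    then obtain d' where "d' \<in> natural_tiling n" "c \<in> d'" by blast
    then show "d \<in> natural_tiling n" using disj[of d d' c] sub d c by blast
  qed
  ultimately show ?thesis by blast
qed

lemma aztec_verts_alt:
  "aztec_verts n = {(of_int a + 1, of_int b + 1/2) | a b.
     - aztec_row n b \<le> a \<and> a < aztec_row n b \<and> even (a + aztec_row n b)}"
proof -
  have image: "f ` {g a b | a b. P a b} = {f (g a b) | a b. P a b}"
    for f :: "cell set \<Rightarrow> real \<times> real" and g :: "int \<Rightarrow> int \<Rightarrow> cell set" and P
    by blast
  have "domino_center {(a, b), (a + 1, b)} = (of_int a + 1, of_int b + 1/2)" for a b
    by (simp add: domino_center_def)
  then show ?thesis
    unfolding aztec_verts_def natural_tiling_alt image by (simp only:)
qed

lemma aztec_row_image: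
  assumes "aztec_row n b = int n"
  shows "(\<lambda>i. (2 * real i - real n - 1, of_int b + 1/2)) ` {1..n} =
    {p \<in> aztec_verts n. snd p = of_int b + 1/2}"
proof (intro equalityI subsetI)
  fix p :: "real \<times> real" assume "p \<in> (\<lambda>i. (2 * real i - real n - 1, of_int b + 1/2)) ` {1..n}"
  then obtain i where i: "1 \<le> i" "i \<le> n" "p = (2 * real i - real n - 1, of_int b + 1/2)" by auto
  have "(of_int (2 * int i - int n - 2) + 1, of_int b + 1/2) \<in> aztec_verts n"
    unfolding aztec_verts_alt using i assms
    by (intro CollectI exI[of _ "2 * int i - int n - 2"] exI[of _ b]) auto
  then show "p \<in> {p \<in> aztec_verts n. snd p = of_int b + 1/2}" using i by (simp add: algebra_simps)
next
  fix p assume "p \<in> {p \<in> aztec_verts n. snd p = of_int b + 1/2}"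
  then obtain a where a: "p = (of_int a + 1, of_int b + 1/2)" "- int n \<le> a" "a < int n"
      "even (a + int n)"
    unfolding aztec_verts_alt using assms by auto
  define i where "i = nat ((a + int n) div 2 + 1)"
  have "2 * int i = a + int n + 2" using a unfolding i_def by auto
  then have "real_of_int (2 * int i) = real_of_int (a + int n + 2)" by simp
  then have "p = (2 * real i - real n - 1, of_int b + 1/2)" "i \<in> {1..n}"
    using a \<open>2 * int i = a + int n + 2\<close> by auto
  then show "p \<in> (\<lambda>i. (2 * real i - real n - 1, of_int b + 1/2)) ` {1..n}" by blast
qed

text \<open>There is no vertex strictly between the heights \<open>-1/2\<close> and \<open>1/2\<close>, so these two heights are
  those of the bottom row of the top half and of the top row of the bottom half.\<close>

lemma aztec_verts_height: "p \<in> aztec_verts n \<Longrightarrow> snd p \<ge> 1/2 \<or> snd p \<le> - 1/2"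
proof -
  assume "p \<in> aztec_verts n"
  then obtain b :: int where b: "snd p = of_int b + 1/2" unfolding aztec_verts_alt by auto
  have "b \<ge> 0 \<or> b \<le> - 1" by arith
  then have "real_of_int b \<ge> 0 \<or> real_of_int b \<le> - 1" by linarith
  then show ?thesis using b by auto
qed

lemma aztec_v_row:
  "aztec_v n ` {1..n} = {p \<in> aztec_verts n. snd p = 1/2}"
  "i < j \<Longrightarrow> fst (aztec_v n i) < fst (aztec_v n j)"
  using aztec_row_image[of n 0] by (auto simp: aztec_v_def[abs_def] aztec_row_def)

lemma aztec_w_row:
  "aztec_w n ` {n + 1..2 * n} = {p \<in> aztec_verts n. snd p = - 1/2}"
  "i < j \<Longrightarrow> fst (aztec_w n i) < fst (aztec_w n j)"
proof -
  have "(+) n ` {1..n} = {n + 1..2 * n}" by (simp add: mult_2)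
  then have "{n + 1..2 * n} = (\<lambda>i. n + i) ` {1..n}" by simp
  then have "aztec_w n ` {n + 1..2 * n} = (\<lambda>i. aztec_w n (n + i)) ` {1..n}"
    by (simp only: image_image)
  also have "\<dots> = {p \<in> aztec_verts n. snd p = - 1/2}"
    using aztec_row_image[of n "-1"] by (simp add: aztec_w_def aztec_row_def)
  finally show "aztec_w n ` {n + 1..2 * n} = {p \<in> aztec_verts n. snd p = - 1/2}" .
qed (simp add: aztec_w_def)

lemma finite_aztec_verts: "finite (aztec_verts n)"
proof -
  have "natural_tiling n \<subseteq> Pow (aztec_diamond n)"
    using natural_tiling[of n] by (auto simp: domino_tilings_def partition_on_def)
  then show ?thesis
    unfolding aztec_verts_def by (meson finite_Pow_iff finite_aztec_diamond finite_imageI finite_subset)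
qed

lemma aztec_digraph_fin_digraph: "fin_digraph (with_proj (aztec_digraph n))"
proof -
  have v: "aztec_v n i \<in> aztec_verts n" if "i \<in> {1..n}" for i
    using aztec_v_row(1)[of n] that by blast
  have w: "aztec_w n (n + i) \<in> aztec_verts n" if "i \<in> {1..n}" for i
  proof -
    have "n + i \<in> {n + 1..2 * n}" using that by auto
    then show ?thesis using aztec_w_row(1)[of n] by blast
  qed
  have sub: "aztec_arcs n \<subseteq> aztec_verts n \<times> aztec_verts n"
    unfolding aztec_arcs_def using v w by blast
  show ?thesis
  proof
    show "finite (arcs (with_proj (aztec_digraph n)))"
      using finite_subset[OF sub] by (simp add: aztec_digraph_def finite_aztec_verts)
  qed (use sub in \<open>auto simp: aztec_digraph_def finite_aztec_verts\<close>)
qed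

lemma aztec_halves_fin_digraph:
  "fin_digraph (aztec_upper n)" "fin_digraph (aztec_lower n)"
proof -
  interpret fin_digraph "with_proj (aztec_digraph n)" by (rule aztec_digraph_fin_digraph)
  have "fin_digraph (with_proj (aztec_digraph n) \<restriction> S)" if "S \<subseteq> aztec_verts n" for S
  proof
    show "finite (verts (with_proj (aztec_digraph n) \<restriction> S))"
      using that finite_aztec_verts finite_subset by auto
    show "finite (arcs (with_proj (aztec_digraph n) \<restriction> S))"
      using finite_arcs by simp
  qed auto
  note * = this
  show "fin_digraph (aztec_upper n)" unfolding aztec_upper_def by (rule *) auto
  show "fin_digraph (aztec_lower n)" unfolding aztec_lower_def by (rule *) auto
qed

text \<open>Hence \<open>path_count\<close> never takes the cardinality of an infinite set here.\<close>

lemma finite_aztec_paths: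
  "finite {p. pre_digraph.apath (aztec_upper n) u p u'}"
  "finite {p. pre_digraph.apath (aztec_lower n) u p u'}"
  using aztec_halves_fin_digraph by (auto intro: fin_digraph.apaths_finite)

end

theory Submission
  imports
    Defs
    "HOL-Computational_Algebra.Formal_Power_Series"
begin

text \<open>Both sides satisfy \<open>f (n + 1) = 2 ^ (n + 1) * f n\<close> and \<open>f 0 = 1\<close>.

  For the tilings, take the \<open>2 \<times> 2\<close> blocks centered at the lattice points \<open>(x, y)\<close> with
  \<open>\<bar>x\<bar> + \<bar>y\<bar> \<le> m\<close> and \<open>x + y \<equiv> m\<close> modulo \<open>2\<close>. Every domino of \<open>AD\<^sub>m\<^sub>+\<^sub>1\<close>
  lies in exactly one of them, so a tiling is an assignment of the cells to the blocks together with
  tilings of the parts \<open>X\<close> that the blocks receive. The same blocks serve \<open>AD\<^sub>m\<close>, and assigning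
  every cell to its other block replaces each \<open>X\<close> by its complement in the block. If \<open>t\<close> counts
  tilings, then \<open>2 t(X) = 2 ^ (card X / 2) t(X\<^sup>c)\<close>; the product over the \<open>(m + 1)\<^sup>2\<close>
  blocks gives the factor \<open>2 ^ ((m + 1) (m + 2) - (m + 1)\<^sup>2)\<close>.

  For the determinant, \<open>det M = det (I + A A\<^sup>T)\<close> where \<open>A\<close> is the upper triangular Toeplitz
  matrix of the large Schroeder series \<open>R\<close>. With the little Schroeder series \<open>S = (1 + R) / 2 = 1 + x R S\<close>,
  also written for its Toeplitz matrix, and \<open>N\<close> the matrix of \<open>x\<close>,
  \<open>I + A A\<^sup>T = 2 S (I + N A A\<^sup>T N\<^sup>T) S\<^sup>T\<close>, and the middle factor is block diagonal with
  blocks \<open>I + A A\<^sup>T\<close> of size one less and \<open>1\<close>.\<close>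

section \<open>Schroeder series and Toeplitz matrices\<close>

text \<open>The numbers 1, 1, 3, 11, 45, ...: the recursion is \<open>S = 1 + x (2 S^2 - S)\<close>
  read coefficientwise. Starting from \<open>S\<close> and setting \<open>R = 2 S - 1\<close> avoids
  halving over the integers.\<close>

fun little_schroeder :: "nat \<Rightarrow> int" where
  "little_schroeder 0 = 1"
| "little_schroeder (Suc m) =
     2 * (\<Sum>i\<le>m. little_schroeder i * little_schroeder (m - i)) - little_schroeder m"

definition little_schroeder_fps :: "int fps" where
  "little_schroeder_fps = Abs_fps little_schroeder"

definition schroeder_fps :: "int fps" where
  "schroeder_fps = 2 * little_schroeder_fps - 1"

lemma little_schroeder_fps_eq:
  "little_schroeder_fps = 1 + fps_X * (schroeder_fps * little_schroeder_fps)"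
proof (rule fps_ext)
  fix m
  let ?S = little_schroeder_fps
  have *: "schroeder_fps * ?S = ?S * ?S + ?S * ?S - ?S"
    by (simp add: schroeder_fps_def algebra_simps)
  have "fps_nth (?S * ?S) k = (\<Sum>i\<le>k. little_schroeder i * little_schroeder (k - i))" for k
    by (simp add: fps_mult_nth little_schroeder_fps_def atLeast0AtMost)
  then have "fps_nth (?S * ?S + ?S * ?S - ?S) k = little_schroeder (Suc k)" for k
    unfolding fps_add_nth fps_sub_nth by (simp add: little_schroeder_fps_def)
  then show "fps_nth ?S m = fps_nth (1 + fps_X * (schroeder_fps * ?S)) m"
    unfolding * by (cases m) (simp_all add: little_schroeder_fps_def)
qed

text \<open>Doubling the equation for \<open>S\<close> and putting \<open>2 S = 1 + R\<close>
  eliminates \<open>S\<close>. The terms on the right are the empty path, a first level step, and a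
  first up step with its return.\<close>

lemma schroeder_fps_eq:
  "schroeder_fps = 1 + fps_X * schroeder_fps + fps_X * schroeder_fps ^ 2"
proof -
  have "schroeder_fps = 1 + 2 * (little_schroeder_fps - 1)" by (simp add: schroeder_fps_def)
  also have "\<dots> = 1 + fps_X * (schroeder_fps * (2 * little_schroeder_fps))"
    by (subst little_schroeder_fps_eq) (simp add: algebra_simps)
  also have "2 * little_schroeder_fps = 1 + schroeder_fps" by (simp add: schroeder_fps_def)
  finally show ?thesis by (simp add: algebra_simps power2_eq_square)
qed

lemma schroeder_fps_nth_0: "fps_nth schroeder_fps 0 = 1"
  by (subst schroeder_fps_eq) simp

definition upper_toeplitz :: "nat \<Rightarrow> 'a :: comm_ring_1 fps \<Rightarrow> 'a mat" where
  "upper_toeplitz n f = mat n n (\<lambda>(i, j). if i \<le> j then fps_nth f (j - i) else 0)"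

lemma upper_toeplitz_carrier [simp]: "upper_toeplitz n f \<in> carrier_mat n n"
  and upper_toeplitz_index:
    "i < n \<Longrightarrow> j < n \<Longrightarrow> upper_toeplitz n f $$ (i, j) = (if i \<le> j then fps_nth f (j - i) else 0)"
  and upper_toeplitz_dim [simp]:
    "dim_row (upper_toeplitz n f) = n" "dim_col (upper_toeplitz n f) = n"
  by (auto simp: upper_toeplitz_def)

text \<open>Only indices between \<open>i\<close> and \<open>j\<close> contribute to an entry of the
  product, so truncation to size \<open>n\<close> loses nothing and the sum is a Cauchy
  product.\<close>

lemma upper_toeplitz_mult: "upper_toeplitz n f * upper_toeplitz n g = upper_toeplitz n (f * g)"
proof (rule eq_matI)
  fix i j assume "i < dim_row (upper_toeplitz n (f * g))" "j < dim_col (upper_toeplitz n (f * g))"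
  then have ij: "i < n" "j < n" by auto
  let ?t = "\<lambda>k. (if i \<le> k then fps_nth f (k - i) else 0) * (if k \<le> j then fps_nth g (j - k) else 0)"
  have "(upper_toeplitz n f * upper_toeplitz n g) $$ (i, j) = (\<Sum>k\<in>{0..<n}. ?t k)"
    using ij by (simp add: scalar_prod_def upper_toeplitz_index)
  also have "\<dots> = (\<Sum>k\<in>{i..j}. ?t k)"
    by (rule sum.mono_neutral_right) (use ij in auto)
  also have "\<dots> = upper_toeplitz n (f * g) $$ (i, j)"
  proof (cases "i \<le> j")
    case True
    have "(\<Sum>k\<in>{i..j}. ?t k) = (\<Sum>k\<in>{0..j - i}. fps_nth f k * fps_nth g (j - i - k))"
      by (rule sum.reindex_bij_witness[of _ "\<lambda>k. k + i" "\<lambda>k. k - i"]) (use True in auto)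
    then show ?thesis using ij True by (simp add: upper_toeplitz_index fps_mult_nth)
  qed (use ij in \<open>simp add: upper_toeplitz_index\<close>)
  finally show "(upper_toeplitz n f * upper_toeplitz n g) $$ (i, j) = upper_toeplitz n (f * g) $$ (i, j)" .
qed auto

lemma det_upper_toeplitz: "det (upper_toeplitz n f) = fps_nth f 0 ^ n"
proof -
  have "upper_triangular (upper_toeplitz n f)"
    by (auto simp: upper_triangular_def upper_toeplitz_index)
  from det_upper_triangular[OF this upper_toeplitz_carrier] show ?thesis
    by (simp add: prod_list_diag_prod upper_toeplitz_index)
qed

section \<open>Gram matrices and the determinant recursion\<close>

definition toeplitz_gram :: "nat \<Rightarrow> 'a :: comm_ring_1 fps \<Rightarrow> 'a mat" where
  "toeplitz_gram n f = upper_toeplitz n f * transpose_mat (upper_toeplitz n f)"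

lemma toeplitz_gram_carrier [simp]: "toeplitz_gram n f \<in> carrier_mat n n"
  and toeplitz_gram_dim [simp]: "dim_row (toeplitz_gram n f) = n" "dim_col (toeplitz_gram n f) = n"
  by (auto simp: toeplitz_gram_def intro!: mult_carrier_mat)

lemma toeplitz_gram_index:
  assumes "i < n" "j < n"
  shows "toeplitz_gram n f $$ (i, j) =
    (\<Sum>k<n. upper_toeplitz n f $$ (i, k) * upper_toeplitz n f $$ (j, k))"
  using assms by (simp add: toeplitz_gram_def scalar_prod_def atLeast0LessThan)

text \<open>Multiplication by \<open>fps_X\<close> moves all entries one column to the right: the
  first column and the last row vanish, and the rest is the matrix of \<open>f\<close> of size
  \<open>n\<close>. The zero row leaves just the last diagonal 1.\<close>

lemma one_plus_toeplitz_gram_shift: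
  fixes f :: "'a :: comm_ring_1 fps"
  shows "1\<^sub>m (Suc n) + toeplitz_gram (Suc n) (fps_X * f) =
    four_block_mat (1\<^sub>m n + toeplitz_gram n f) (0\<^sub>m n 1) (0\<^sub>m 1 n) (1\<^sub>m 1)"
    (is "?L = ?R")
proof (rule eq_matI)
  fix i j assume "i < dim_row ?R" "j < dim_col ?R"
  then have ij: "i < Suc n" "j < Suc n" by auto
  have shift: "upper_toeplitz (Suc n) (fps_X * f) $$ (i, Suc k) =
      (if i < n then upper_toeplitz n f $$ (i, k) else 0)" if "i < Suc n" "k < n" for i k
    using that by (auto simp: upper_toeplitz_index Suc_diff_le)
  have shift0: "upper_toeplitz (Suc n) (fps_X * f) $$ (i, 0) = 0" if "i < Suc n" for i
    using that by (auto simp: upper_toeplitz_index)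
  have "toeplitz_gram (Suc n) (fps_X * f) $$ (i, j) =
      (\<Sum>k<n. upper_toeplitz (Suc n) (fps_X * f) $$ (i, Suc k) *
        upper_toeplitz (Suc n) (fps_X * f) $$ (j, Suc k))"
    using ij by (simp add: toeplitz_gram_index sum.lessThan_Suc_shift shift0 del: sum.lessThan_Suc)
  also have "\<dots> = (if i < n \<and> j < n then toeplitz_gram n f $$ (i, j) else 0)"
    using ij by (cases "i < n \<and> j < n") (auto simp: shift toeplitz_gram_index intro!: sum.neutral)
  finally show "?L $$ (i, j) = ?R $$ (i, j)" using ij by auto
qed auto

text \<open>Since \<open>S (x R) = S - 1\<close>, the product inside is
  \<open>S S^T + (S - 1) (S - 1)^T\<close>. Twice this expands to
  \<open>1 + (2 S - 1) (2 S - 1)^T\<close>, and \<open>2 S - 1 = R\<close>.\<close>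

lemma one_plus_toeplitz_gram_factor:
  "1\<^sub>m (Suc n) + toeplitz_gram (Suc n) schroeder_fps =
    2 \<cdot>\<^sub>m (upper_toeplitz (Suc n) little_schroeder_fps *
      four_block_mat (1\<^sub>m n + toeplitz_gram n schroeder_fps) (0\<^sub>m n 1) (0\<^sub>m 1 n) (1\<^sub>m 1) *
      transpose_mat (upper_toeplitz (Suc n) little_schroeder_fps))"
proof -
  let ?N = "Suc n" and ?S = "little_schroeder_fps" and ?R = "schroeder_fps"
  let ?U = "upper_toeplitz ?N"
  have c [simp]: "transpose_mat (?U f) \<in> carrier_mat ?N ?N" for f :: "int fps" by simp
  have SX: "?S * (fps_X * ?R) = ?S - 1"
    by (subst (2) little_schroeder_fps_eq) (simp add: algebra_simps)
  have "?U ?S * (1\<^sub>m ?N + toeplitz_gram ?N (fps_X * ?R)) * transpose_mat (?U ?S) =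
      toeplitz_gram ?N ?S + ?U ?S * toeplitz_gram ?N (fps_X * ?R) * transpose_mat (?U ?S)"
    by (simp add: mult_add_distrib_mat[of _ ?N ?N _ ?N] add_mult_distrib_mat[of _ ?N ?N _ _ ?N]
        mult_carrier_mat[of _ ?N ?N _ ?N] toeplitz_gram_def[of ?N ?S])
  also have "?U ?S * toeplitz_gram ?N (fps_X * ?R) * transpose_mat (?U ?S) =
      (?U ?S * ?U (fps_X * ?R)) * transpose_mat (?U ?S * ?U (fps_X * ?R))"
    unfolding toeplitz_gram_def
    by (simp add: transpose_mult[of _ ?N ?N _ ?N] assoc_mult_mat[of _ ?N ?N _ ?N _ ?N]
        mult_carrier_mat[of _ ?N ?N _ ?N])
  also have "\<dots> = toeplitz_gram ?N (?S - 1)"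
    unfolding upper_toeplitz_mult SX toeplitz_gram_def ..
  finally have *: "?U ?S * (1\<^sub>m ?N + toeplitz_gram ?N (fps_X * ?R)) * transpose_mat (?U ?S) =
    toeplitz_gram ?N ?S + toeplitz_gram ?N (?S - 1)" .
  have "1\<^sub>m ?N + toeplitz_gram ?N ?R = 2 \<cdot>\<^sub>m (toeplitz_gram ?N ?S + toeplitz_gram ?N (?S - 1))"
  proof (rule eq_matI)
    fix i j assume "i < dim_row (2 \<cdot>\<^sub>m (toeplitz_gram ?N ?S + toeplitz_gram ?N (?S - 1)))"
      "j < dim_col (2 \<cdot>\<^sub>m (toeplitz_gram ?N ?S + toeplitz_gram ?N (?S - 1)))"
    then have ij: "i < ?N" "j < ?N" by auto
    let ?d = "\<lambda>i k. of_bool (i = k) :: int"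
    let ?s = "\<lambda>i k. ?U ?S $$ (i, k)"
    have R: "?U ?R $$ (i, k) = 2 * ?s i k - ?d i k" and S: "?U (?S - 1) $$ (i, k) = ?s i k - ?d i k"
      if "i < ?N" "k < ?N" for i k
      using that by (auto simp: upper_toeplitz_index schroeder_fps_def numeral_fps_const)
    \<comment> \<open>The identity matrix is written as its own Gram sum, so that the expansion can
      be checked term by term in \<open>k\<close>.\<close>
    have one: "1\<^sub>m ?N $$ (i, j) = (\<Sum>k<?N. ?d i k * ?d j k)"
    proof -
      have "(\<Sum>k<?N. ?d i k * ?d j k) = (\<Sum>k<?N. if k = i then ?d j k else 0)"
        by (rule sum.cong) auto
      also have "\<dots> = ?d j i" using ij by (subst sum.delta) auto
      finally show ?thesis using ij by auto
    qed
    have "(1\<^sub>m ?N + toeplitz_gram ?N ?R) $$ (i, j) =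
        (\<Sum>k<?N. ?d i k * ?d j k + (2 * ?s i k - ?d i k) * (2 * ?s j k - ?d j k))"
      using ij by (simp add: one toeplitz_gram_index R sum.distrib del: sum.lessThan_Suc index_one_mat)
    also have "\<dots> = (\<Sum>k<?N. 2 * (?s i k * ?s j k + (?s i k - ?d i k) * (?s j k - ?d j k)))"
      by (rule sum.cong) (auto simp: algebra_simps)
    also have "\<dots> = (2 \<cdot>\<^sub>m (toeplitz_gram ?N ?S + toeplitz_gram ?N (?S - 1))) $$ (i, j)"
      using ij by (simp add: toeplitz_gram_index S sum.distrib sum_distrib_left distrib_left del: sum.lessThan_Suc)
    finally show "(1\<^sub>m ?N + toeplitz_gram ?N ?R) $$ (i, j) =
      (2 \<cdot>\<^sub>m (toeplitz_gram ?N ?S + toeplitz_gram ?N (?S - 1))) $$ (i, j)" .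
  qed auto
  then show ?thesis unfolding * [symmetric] one_plus_toeplitz_gram_shift .
qed

text \<open>The outer factors are unitriangular because \<open>S\<close> has constant term 1, so
  only the scalar 2 contributes, once for each of the \<open>Suc n\<close> rows.\<close>

lemma det_one_plus_toeplitz_gram_Suc:
  "det (1\<^sub>m (Suc n) + toeplitz_gram (Suc n) schroeder_fps) =
    2 ^ Suc n * det (1\<^sub>m n + toeplitz_gram n schroeder_fps)"
proof -
  let ?U = "upper_toeplitz (Suc n) little_schroeder_fps"
  let ?F = "four_block_mat (1\<^sub>m n + toeplitz_gram n schroeder_fps) (0\<^sub>m n 1) (0\<^sub>m 1 n) (1\<^sub>m 1)"
  have F: "?F \<in> carrier_mat (Suc n) (Suc n)"
    using four_block_carrier_mat[of "1\<^sub>m n + toeplitz_gram n schroeder_fps" n n "1\<^sub>m 1" 1 1] by simp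
  have "det ?F = det (1\<^sub>m n + toeplitz_gram n schroeder_fps)"
    by (subst det_four_block_mat_upper_right_zero[of _ n _ 1]) auto
  moreover have "det (?U * ?F * transpose_mat ?U) = det ?U * det ?F * det ?U"
  proof -
    have "det (?U * ?F * transpose_mat ?U) = det (?U * ?F) * det (transpose_mat ?U)"
      by (rule det_mult[of _ "Suc n"]) (use F in \<open>auto intro!: mult_carrier_mat\<close>)
    also have "det (?U * ?F) = det ?U * det ?F" by (rule det_mult[OF upper_toeplitz_carrier F])
    also have "det (transpose_mat ?U) = det ?U" by (rule det_transpose[OF upper_toeplitz_carrier])
    finally show ?thesis .
  qed
  moreover have "det ?U = 1" by (simp add: det_upper_toeplitz little_schroeder_fps_def)
  ultimately show ?thesis
    unfolding one_plus_toeplitz_gram_factor[of n] by simp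
qed

section \<open>Schroeder paths\<close>

text \<open>Arcs lower the rank, so no walk revisits a vertex and paths split by their first arc.
  From \<open>t\<close> to itself only the trivial path remains.\<close>

lemma path_count_ranked:
  fixes rk :: "'a \<Rightarrow> nat"
  assumes G: "fin_digraph G"
    and rk: "\<And>e. e \<in> arcs G \<Longrightarrow> rk (head G e) < rk (tail G e)"
    and u: "u \<in> verts G"
  shows "path_count G u t = (if u = t then 1 else \<Sum>e\<in>out_arcs G u. path_count G (head G e) t)"
proof -
  interpret fin_digraph G by (rule G)
  have le: "rk w \<le> rk a" if "awalk a p b" "w \<in> set (awalk_verts a p)" for a p b w
    using that
  proof (induction p arbitrary: a)
    case (Cons e p)
    then have e: "e \<in> arcs G" "tail G e = a" "awalk (head G e) p b"
      by (auto simp: awalk_Cons_iff)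
    then have "w = a \<or> w \<in> set (awalk_verts (head G e) p)" using Cons.prems by auto
    then show ?case using Cons.IH[OF e(3)] rk[OF e(1)] e(2) by auto
  qed auto
  \<comment> \<open>Distinctness comes for free: \<open>a\<close> has larger rank than every vertex
    of the remaining walk.\<close>
  have apath_iff: "apath a (e # p) b \<longleftrightarrow> e \<in> out_arcs G a \<and> apath (head G e) p b" for a e p b
  proof -
    have "a \<notin> set (awalk_verts (head G e) p)"
      if "e \<in> arcs G" "tail G e = a" "apath (head G e) p b"
      using le[of "head G e" p b a] rk[OF that(1)] that by (auto simp: apath_def)
    then show ?thesis by (auto simp: apath_Cons_iff)
  qed
  show ?thesis
  proof (cases "u = t")
    case True
    have "p = []" if p: "apath u p t" for p
    proof (cases p)
      case (Cons e q)
      then have "apath (head G e) q t" and e: "e \<in> arcs G" "tail G e = u"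
        using p by (auto simp: apath_iff)
      then have "awalk (head G e) q t" by (auto simp: apath_def)
      then have "t \<in> set (awalk_verts (head G e) q)" by auto
      then show ?thesis
        using le[OF \<open>awalk (head G e) q t\<close>, of t] rk[OF e(1)] e(2) True by auto
    qed
    then have "{p. apath u p t} = {[]}" using True u by (auto simp: apath_Nil_iff)
    then show ?thesis using True by (simp add: path_count_def)
  next
    case False
    have "{p. apath u p t} = (\<Union>e\<in>out_arcs G u. (#) e ` {p. apath (head G e) p t})" (is "?L = ?R")
    proof (intro equalityI subsetI)
      fix p assume "p \<in> ?L"
      then show "p \<in> ?R" using False by (cases p) (auto simp: apath_iff apath_Nil_iff)
    qed (auto simp: apath_iff)
    also have "card \<dots> = (\<Sum>e\<in>out_arcs G u. card ((#) e ` {p. apath (head G e) p t}))"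
      by (rule card_UN_disjoint) (auto simp: apaths_finite)
    also have "\<dots> = (\<Sum>e\<in>out_arcs G u. path_count G (head G e) t)"
      by (simp add: path_count_def card_image)
    finally show ?thesis using False by (simp add: path_count_def)
  qed
qed

section \<open>The step recursion and its solution by powers of the Schroeder series\<close>

text \<open>The vertex \<open>(h, i)\<close> is the one with index \<open>i\<close>, counted from \<open>0\<close>, in row \<open>h\<close> of the
  half; this row has \<open>n - h\<close> vertices.\<close>

definition schroeder_steps :: "nat \<Rightarrow> nat \<times> nat \<Rightarrow> (nat \<times> nat) set" where
  "schroeder_steps n = (\<lambda>(h, i).
     {(h, i + 1), (h + 1, i)} \<inter> {(h', i'). h' + i' < n} \<union> (if h > 0 then {(h - 1, i + 1)} else {}))"

text \<open>A path from \<open>(h, i)\<close> to \<open>(0, j)\<close> splits at its first visits to the heights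
  \<open>h - 1, \<dots>, 0\<close> into \<open>h + 1\<close> Schroeder paths, whence the exponent.\<close>

definition schroeder_count :: "nat \<Rightarrow> nat \<times> nat \<Rightarrow> int" where
  "schroeder_count j = (\<lambda>(h, i). if h + i \<le> j then fps_nth (schroeder_fps ^ (h + 1)) (j - i - h) else 0)"

text \<open>The equation for \<open>R\<close> times \<open>R^h\<close>. Its three terms are the
  down, level and up step from height \<open>h\<close>; only the last two carry a factor
  \<open>x\<close>.\<close>

lemma schroeder_fps_power:
  "schroeder_fps ^ (h + 1) =
    schroeder_fps ^ h + fps_X * (schroeder_fps ^ (h + 1) + schroeder_fps ^ (h + 2))"
proof -
  have "schroeder_fps ^ (h + 1) = schroeder_fps ^ h * schroeder_fps" by simp
  also have "\<dots> = schroeder_fps ^ h * (1 + fps_X * schroeder_fps + fps_X * schroeder_fps ^ 2)"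
    using arg_cong[OF schroeder_fps_eq, of "(*) (schroeder_fps ^ h)"] .
  also have "\<dots> = schroeder_fps ^ h +
      fps_X * (schroeder_fps ^ (h + 1) + schroeder_fps ^ (h + 2))"
    by (simp add: algebra_simps power2_eq_square)
  finally show ?thesis .
qed

lemma schroeder_count_rec:
  assumes "j < n" "h + i < n" "(h, i) \<noteq> (0, j)"
  shows "schroeder_count j (h, i) = (\<Sum>p\<in>schroeder_steps n (h, i). schroeder_count j p)"
proof -
  let ?c = "schroeder_count j"
  let ?A = "{(h, i + 1), (h + 1, i)} \<inter> {(h', i'). h' + i' < n}"
  let ?D = "(if h > 0 then {(h - 1, i + 1)} else {})"
  have "?A \<inter> ?D = {}" by auto
  then have "(\<Sum>p\<in>schroeder_steps n (h, i). ?c p) = sum ?c ?A + sum ?c ?D"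
    unfolding schroeder_steps_def prod.case by (intro sum.union_disjoint) auto
  \<comment> \<open>A point beyond the boundary has \<open>h' + i' \<ge> n > j\<close>, where the
    count is 0.\<close>
  also have "sum ?c ?A = sum ?c {(h, i + 1), (h + 1, i)}"
    by (rule sum.mono_neutral_left) (use assms(1) in \<open>auto simp: schroeder_count_def split: if_splits\<close>)
  also have "\<dots> = ?c (h, i + 1) + ?c (h + 1, i)" by simp
  also have "sum ?c ?D = (if h > 0 then ?c (h - 1, i + 1) else 0)" by simp
  finally have *: "(\<Sum>p\<in>schroeder_steps n (h, i). ?c p) =
    ?c (h, i + 1) + ?c (h + 1, i) + (if h > 0 then ?c (h - 1, i + 1) else 0)" .
  have nth: "fps_nth (schroeder_fps ^ (h + 1)) m = fps_nth (schroeder_fps ^ h) m +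
      (if m = 0 then 0 else fps_nth (schroeder_fps ^ (h + 1)) (m - 1) +
        fps_nth (schroeder_fps ^ (h + 2)) (m - 1))" for m
    by (subst schroeder_fps_power) simp
  show ?thesis
  proof (cases "h + i \<le> j")
    case True
    have "j - (i + 1) - h = j - i - h - 1" "j - i - (h + 1) = j - i - h - 1" "0 < j - i - h \<longleftrightarrow> h + i + 1 \<le> j"
      by auto
    then have "?c (h, i + 1) + ?c (h + 1, i) = (if j - i - h = 0 then 0 else
        fps_nth (schroeder_fps ^ (h + 1)) (j - i - h - 1) +
        fps_nth (schroeder_fps ^ (h + 2)) (j - i - h - 1))"
      using True by (auto simp: schroeder_count_def)
    \<comment> \<open>For \<open>h = 0\<close> there is no down step, and \<open>R^0 = 1\<close> has
      coefficient 0 at \<open>j - i\<close> because the target itself is excluded.\<close>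
    moreover have "(if h > 0 then ?c (h - 1, i + 1) else 0) = fps_nth (schroeder_fps ^ h) (j - i - h)"
      using True assms(3) by (cases h) (auto simp: schroeder_count_def)
    ultimately show ?thesis unfolding * using nth[of "j - i - h"] True
      by (simp add: schroeder_count_def)
  next
    case False
    then show ?thesis unfolding * by (auto simp: schroeder_count_def)
  qed
qed

text \<open>Path counts and \<open>schroeder_count\<close> obey the same recursion over steps. The
  graph enters only through the coordinates \<open>pt\<close>, so one induction serves both
  halves.\<close>

lemma path_count_schroeder:
  fixes G :: "('a, 'a \<times> 'a) pre_digraph"
  assumes G: "fin_digraph G" "tail G = fst" "head G = snd"
    and inj: "inj_on pt {(h, i). h + i < n}"
    and verts: "verts G = pt ` {(h, i). h + i < n}"
    and arcs: "\<And>p q. p \<in> {(h, i). h + i < n} \<Longrightarrow> (pt p, q) \<in> arcs G \<longleftrightarrow> q \<in> pt ` schroeder_steps n p"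
    and p: "fst p + snd p < n" and j: "j < n"
  shows "int (path_count G (pt p) (pt (0, j))) = schroeder_count j p"
proof -
  define V where "V = {(h :: nat, i). h + i < n}"
  have steps: "schroeder_steps n p \<subseteq> V" if "p \<in> V" for p
    using that by (auto simp: schroeder_steps_def V_def split: if_splits)
  \<comment> \<open>Every step increases \<open>h + 2 * i\<close>, the abscissa up to sign and
    shift; this stays below \<open>2 * n\<close>, so the difference is a rank.\<close>
  define m where "m = (\<lambda>(h :: nat, i :: nat). 2 * n - (h + 2 * i))"
  have m: "m q < m p" if "p \<in> V" "q \<in> schroeder_steps n p" for p q
    using that by (auto simp: schroeder_steps_def V_def m_def split: if_splits)
  note inj = inj[folded V_def] and verts = verts[folded V_def] and arcs = arcs[folded V_def]
  let ?rk = "\<lambda>u. m (the_inv_into V pt u)"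
  have rk_pt: "?rk (pt p) = m p" if "p \<in> V" for p using the_inv_into_f_f[OF inj that] by simp
  have rk: "?rk (head G e) < ?rk (tail G e)" if "e \<in> arcs G" for e
  proof -
    have "fst e \<in> verts G"
      using G that by (metis fin_digraph.axioms(1) wf_digraph.tail_in_verts)
    then obtain p where p: "p \<in> V" "fst e = pt p" unfolding verts by auto
    then have "snd e \<in> pt ` schroeder_steps n p" using arcs[OF p(1), of "snd e"] that by (metis prod.collapse)
    then obtain q where q: "q \<in> schroeder_steps n p" "snd e = pt q" by auto
    then show ?thesis using m[OF p(1) q(1)] p q steps[OF p(1)] by (auto simp: G rk_pt)
  qed
  have "p \<in> V" using p by (cases p) (auto simp: V_def)
  then show ?thesis
  proof (induction "m p" arbitrary: p rule: less_induct)
    case less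
    have t: "(0, j) \<in> V" using j by (auto simp: V_def)
    show ?case
    proof (cases "p = (0, j)")
      case True
      have "path_count G (pt p) (pt (0, j)) = 1"
        using path_count_ranked[OF G(1) rk, of "pt p" "pt (0, j)"] less.prems True verts by auto
      then show ?thesis using True by (simp add: schroeder_count_def schroeder_fps_nth_0)
    next
      case False
      then have ne: "pt p \<noteq> pt (0, j)" using inj less.prems t by (auto dest: inj_onD)
      have inj': "inj_on pt (schroeder_steps n p)"
        using inj_on_subset[OF inj steps[OF less.prems]] .
      have out: "out_arcs G (pt p) = (\<lambda>q. (pt p, pt q)) ` schroeder_steps n p"
        unfolding out_arcs_def using arcs[OF less.prems] by (auto simp: G)
      have "int (path_count G (pt p) (pt (0, j))) =
          (\<Sum>e\<in>out_arcs G (pt p). int (path_count G (head G e) (pt (0, j))))"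
        using path_count_ranked[OF G(1) rk, of "pt p" "pt (0, j)"] less.prems verts ne by auto
      also have "\<dots> = (\<Sum>q\<in>schroeder_steps n p. int (path_count G (pt q) (pt (0, j))))"
        unfolding out using inj' by (subst sum.reindex) (auto simp: inj_on_def G)
      also have "\<dots> = (\<Sum>q\<in>schroeder_steps n p. schroeder_count j q)"
        using less.hyps[OF m[OF less.prems]] steps[OF less.prems] by (intro sum.cong) auto
      also have "\<dots> = schroeder_count j p"
        using schroeder_count_rec[OF j, of "fst p" "snd p"] False less.prems
        by (cases p) (auto simp: V_def)
      finally show ?thesis .
    qed
  qed
qed

section \<open>Tilings and blocks\<close>

text \<open>The center of the block is the lattice point \<open>(x, y)\<close>.\<close>

definition block :: "cell \<Rightarrow> cell set" where
  "block = (\<lambda>(x, y). {x - 1, x} \<times> {y - 1, y})"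

definition domino :: "cell set \<Rightarrow> bool" where
  "domino d \<longleftrightarrow> horizontal_domino d \<or> vertical_domino d"

lemma not_domino_empty: "\<not> domino {}"
  by (auto simp: domino_def horizontal_domino_def vertical_domino_def)

lemma domino_tilings_iff:
  "T \<in> domino_tilings R \<longleftrightarrow>
    \<Union>T = R \<and> (\<forall>d\<in>T. domino d) \<and> (\<forall>d\<in>T. \<forall>d'\<in>T. \<forall>c. c \<in> d \<longrightarrow> c \<in> d' \<longrightarrow> d = d')"
proof -
  have ne: "{} \<notin> T" if "\<forall>d\<in>T. domino d" using that not_domino_empty by blast
  have disj: "disjoint T \<longleftrightarrow> (\<forall>d\<in>T. \<forall>d'\<in>T. \<forall>c. c \<in> d \<longrightarrow> c \<in> d' \<longrightarrow> d = d')"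
    unfolding disjoint_def by (simp add: disjoint_iff) metis
  show ?thesis
    unfolding domino_tilings_def partition_on_def disj[symmetric] domino_def[symmetric] mem_Collect_eq
    using ne by simp metis
qed

lemma domino_tiling_Union: "T \<in> domino_tilings R \<Longrightarrow> \<Union>T = R"
  and domino_tiling_domino: "T \<in> domino_tilings R \<Longrightarrow> d \<in> T \<Longrightarrow> domino d"
  and domino_tiling_unique:
    "T \<in> domino_tilings R \<Longrightarrow> d \<in> T \<Longrightarrow> d' \<in> T \<Longrightarrow> c \<in> d \<Longrightarrow> c \<in> d' \<Longrightarrow> d = d'"
  unfolding domino_tilings_iff by blast+

lemma domino_tilingI:
  "\<Union>T = R \<Longrightarrow> (\<And>d. d \<in> T \<Longrightarrow> domino d) \<Longrightarrow>
    (\<And>d d' c. d \<in> T \<Longrightarrow> d' \<in> T \<Longrightarrow> c \<in> d \<Longrightarrow> c \<in> d' \<Longrightarrow> d = d') \<Longrightarrow> T \<in> domino_tilings R"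
  unfolding domino_tilings_iff by blast

lemma card_domino: "domino d \<Longrightarrow> card d = 2"
  by (auto simp: domino_def horizontal_domino_def vertical_domino_def)

lemma finite_domino_tilings_region: "finite R \<Longrightarrow> finite (domino_tilings R)"
  by (rule finite_subset[of _ "Pow (Pow R)"]) (auto simp: domino_tilings_iff)

text \<open>A tiling amounts to a map \<open>\<sigma>\<close>, sending each cell to the block that
  contains its domino, together with a tiling of each fiber of \<open>\<sigma>\<close>.\<close>

lemma card_domino_tilings_blocks:
  assumes R: "finite R" and B: "finite B"
    and ex: "\<And>d. domino d \<Longrightarrow> d \<subseteq> R \<Longrightarrow> \<exists>!b. b \<in> B \<and> d \<subseteq> block b"
  shows "card (domino_tilings R) =
    (\<Sum>\<sigma>\<in>(\<Pi>\<^sub>E c\<in>R. {b \<in> B. c \<in> block b}). \<Prod>b\<in>B. card (domino_tilings {c \<in> R. \<sigma> c = b}))"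
proof -
  define \<Sigma> where "\<Sigma> = (\<Pi>\<^sub>E c\<in>R. {b \<in> B. c \<in> block b})"
  define P where "P = (SIGMA \<sigma>:\<Sigma>. \<Pi>\<^sub>E b\<in>B. domino_tilings {c \<in> R. \<sigma> c = b})"
  define f where "f = (\<lambda>(\<sigma> :: cell \<Rightarrow> cell, F). \<Union>b\<in>B. F b :: cell set set)"
  have fin: "finite \<Sigma>" unfolding \<Sigma>_def using R B by (intro finite_PiE) auto
  have dom_sub: "d \<subseteq> block b \<and> domino d \<and> d \<subseteq> R"
    if "(\<sigma>, F) \<in> P" "b \<in> B" "d \<in> F b" for \<sigma> F b d
  proof -
    have "F b \<in> domino_tilings {c \<in> R. \<sigma> c = b}" and \<sigma>: "\<sigma> \<in> \<Sigma>"
      using that by (auto simp: P_def)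
    then have "domino d" "d \<subseteq> {c \<in> R. \<sigma> c = b}" using that by (auto simp: domino_tilings_iff)
    moreover from this have "d \<subseteq> block b" using \<sigma> by (auto simp: \<Sigma>_def)
    ultimately show ?thesis by blast
  qed
  \<comment> \<open>The union determines its pieces: a domino lies in one block only, so
    \<open>F b\<close> consists of the dominoes inside \<open>block b\<close>.\<close>
  have restr: "F b = {d \<in> f (\<sigma>, F). d \<subseteq> block b}" if P: "(\<sigma>, F) \<in> P" and b: "b \<in> B" for \<sigma> F b
  proof (intro equalityI subsetI)
    fix d assume "d \<in> F b"
    then show "d \<in> {d \<in> f (\<sigma>, F). d \<subseteq> block b}"
      using dom_sub[OF P b] b by (auto simp: f_def)
  next
    fix d assume "d \<in> {d \<in> f (\<sigma>, F). d \<subseteq> block b}"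
    then obtain b' where "b' \<in> B" "d \<in> F b'" "d \<subseteq> block b" by (auto simp: f_def)
    moreover from this have "b' = b" using ex[of d] dom_sub[OF P] b by blast
    ultimately show "d \<in> F b" by simp
  qed
  have cover: "\<Union>(F b) = {c \<in> R. \<sigma> c = b}" if "(\<sigma>, F) \<in> P" "b \<in> B" for \<sigma> F b
  proof -
    have "F b \<in> domino_tilings {c \<in> R. \<sigma> c = b}" using that by (auto simp: P_def)
    then show ?thesis by (simp add: domino_tilings_iff)
  qed
  have inj: "inj_on f P"
  proof (rule inj_onI)
    fix p p' assume p: "p \<in> P" and p': "p' \<in> P" and eq: "f p = f p'"
    obtain \<sigma> F where [simp]: "p = (\<sigma>, F)" by (cases p)
    obtain \<sigma>' F' where [simp]: "p' = (\<sigma>', F')" by (cases p')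
    have FF: "F b = F' b" if "b \<in> B" for b
      using restr[of \<sigma> F b] restr[of \<sigma>' F' b] p p' eq that by simp
    have \<sigma>: "\<sigma> \<in> \<Sigma>" "\<sigma>' \<in> \<Sigma>" and F: "F \<in> extensional B" "F' \<in> extensional B"
      using p p' by (auto simp: P_def PiE_def)
    have "F = F'" by (rule extensionalityI[OF F]) (rule FF)
    moreover have "\<sigma> c = \<sigma>' c" if c: "c \<in> R" for c
    proof -
      have b: "\<sigma> c \<in> B" using \<sigma> c by (auto simp: \<Sigma>_def)
      then have "c \<in> \<Union>(F (\<sigma> c))" using cover[of \<sigma> F "\<sigma> c"] p c by simp
      moreover have "\<Union>(F (\<sigma> c)) = {c' \<in> R. \<sigma>' c' = \<sigma> c}"
        using cover[of \<sigma>' F' "\<sigma> c"] p' b FF[OF b] by simp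
      ultimately have "c \<in> {c' \<in> R. \<sigma>' c' = \<sigma> c}" by (simp only:)
      then show ?thesis by simp
    qed
    then have "\<sigma> = \<sigma>'" using \<sigma> unfolding \<Sigma>_def by (intro PiE_ext)
    ultimately show "p = p'" by simp
  qed
  have "f ` P = domino_tilings R"
  proof (intro equalityI subsetI)
    fix T assume "T \<in> f ` P"
    then obtain \<sigma> F where P: "(\<sigma>, F) \<in> P" and T: "T = f (\<sigma>, F)" by auto
    then have \<sigma>: "\<sigma> c \<in> B" if "c \<in> R" for c using that by (auto simp: P_def \<Sigma>_def)
    have "\<Union>T = (\<Union>b\<in>B. \<Union>(F b))" unfolding T f_def by auto
    also have "\<dots> = R" using \<sigma> cover[OF P] by auto
    finally have "\<Union>T = R" .
    moreover have "\<forall>d\<in>T. domino d" using dom_sub[OF P] unfolding T f_def by auto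
    moreover have "d = d'" if d: "d \<in> T" "d' \<in> T" and c: "c \<in> d" "c \<in> d'" for d d' c
    proof -
      obtain b b' where b: "b \<in> B" "b' \<in> B" "d \<in> F b" "d' \<in> F b'" using d unfolding T f_def by auto
      have "c \<in> \<Union>(F b)" "c \<in> \<Union>(F b')" using b c by auto
      then have "b = b'" using b cover[OF P] by simp
      moreover have "F b \<in> domino_tilings {c \<in> R. \<sigma> c = b}" using P b by (auto simp: P_def)
      ultimately show ?thesis using b c domino_tiling_unique by metis
    qed
    ultimately show "T \<in> domino_tilings R" by (intro domino_tilingI) auto
  next
    fix T assume T: "T \<in> domino_tilings R"
    define F where "F = (\<lambda>b\<in>B. {d \<in> T. d \<subseteq> block b})"
    define \<sigma> where "\<sigma> = (\<lambda>c\<in>R. THE b. b \<in> B \<and> (\<exists>d\<in>T. c \<in> d \<and> d \<subseteq> block b))"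
    have dT: "domino d" "d \<subseteq> R" if "d \<in> T" for d
      using domino_tiling_domino[OF T that] domino_tiling_Union[OF T] that by auto
    have ex1: "\<exists>!b. b \<in> B \<and> d \<subseteq> block b" if "d \<in> T" for d using ex dT that by blast
    have \<sigma>_eq: "\<sigma> c = b" if "d \<in> T" "c \<in> d" "b \<in> B" "d \<subseteq> block b" for c d b
    proof -
      have "c \<in> R" using that dT by blast
      moreover have "(THE b. b \<in> B \<and> (\<exists>d\<in>T. c \<in> d \<and> d \<subseteq> block b)) = b"
      proof (rule the_equality)
        show "b \<in> B \<and> (\<exists>d\<in>T. c \<in> d \<and> d \<subseteq> block b)" using that by blast
        fix b' assume "b' \<in> B \<and> (\<exists>d\<in>T. c \<in> d \<and> d \<subseteq> block b')"
        then obtain d' where d': "b' \<in> B" "d' \<in> T" "c \<in> d'" "d' \<subseteq> block b'" by blast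
        then have "d' = d" using domino_tiling_unique[OF T] that by blast
        then show "b' = b" using ex1[of d] d' that by blast
      qed
      ultimately show ?thesis by (simp add: \<sigma>_def)
    qed
    have found: "\<exists>d b. d \<in> T \<and> c \<in> d \<and> b \<in> B \<and> d \<subseteq> block b \<and> \<sigma> c = b" if c: "c \<in> R" for c
    proof -
      have "\<Union>T = R" using T by (simp add: domino_tilings_iff)
      then obtain d where d: "d \<in> T" "c \<in> d" using c by blast
      obtain b where "b \<in> B" "d \<subseteq> block b" using ex1 d by blast
      then show ?thesis using \<sigma>_eq[of d c b] d by blast
    qed
    have "\<sigma> \<in> \<Sigma>" unfolding \<Sigma>_def
    proof (rule PiE_I)
      fix c assume "c \<in> R"
      then show "\<sigma> c \<in> {b \<in> B. c \<in> block b}" using found[of c] by blast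
    qed (simp add: \<sigma>_def)
    moreover have "F b \<in> domino_tilings {c \<in> R. \<sigma> c = b}" if b: "b \<in> B" for b
    proof -
      have "\<Union>(F b) = {c \<in> R. \<sigma> c = b}"
      proof (intro equalityI subsetI)
        fix c assume "c \<in> \<Union>(F b)"
        then obtain d where "d \<in> T" "d \<subseteq> block b" "c \<in> d" using b by (auto simp: F_def)
        then show "c \<in> {c \<in> R. \<sigma> c = b}" using \<sigma>_eq[of d c b] b dT by blast
      next
        fix c assume "c \<in> {c \<in> R. \<sigma> c = b}"
        then show "c \<in> \<Union>(F b)" using found[of c] b by (auto simp: F_def)
      qed
      moreover have "d \<in> T" if "d \<in> F b" for d using b that by (auto simp: F_def)
      ultimately show ?thesis
        using domino_tiling_domino[OF T] domino_tiling_unique[OF T] by (intro domino_tilingI) auto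
    qed
    ultimately have "(\<sigma>, F) \<in> P" unfolding P_def by (auto simp: F_def)
    moreover have "\<exists>b\<in>B. d \<subseteq> block b" if "d \<in> T" for d using ex1[OF that] by blast
    then have "f (\<sigma>, F) = T" unfolding f_def by (auto simp: F_def)
    ultimately show "T \<in> f ` P" by (metis image_eqI)
  qed
  then have "card (domino_tilings R) = card P" using card_image[OF inj] by simp
  also have "\<dots> = (\<Sum>\<sigma>\<in>\<Sigma>. card (\<Pi>\<^sub>E b\<in>B. domino_tilings {c \<in> R. \<sigma> c = b}))"
    unfolding P_def using fin B R by (intro card_SigmaI) (auto intro!: finite_PiE finite_domino_tilings_region)
  also have "\<dots> = (\<Sum>\<sigma>\<in>\<Sigma>. \<Prod>b\<in>B. card (domino_tilings {c \<in> R. \<sigma> c = b}))"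
    using B by (simp add: card_PiE)
  finally show ?thesis unfolding \<Sigma>_def .
qed

section \<open>Tilings of subsets of a single block\<close>

lemma card_tiling_dominoes:
  assumes "T \<in> domino_tilings X" "finite X"
  shows "card X = 2 * card T"
proof -
  have "finite T" using assms by (auto simp: domino_tilings_iff intro: finite_UnionD)
  moreover have "\<And>d. d \<in> T \<Longrightarrow> card d = 2" using assms(1) card_domino by (auto simp: domino_tilings_iff)
  moreover have "pairwise disjnt T"
    using domino_tiling_unique[OF assms(1)] unfolding pairwise_def disjnt_def by blast
  moreover have "\<And>d. d \<in> T \<Longrightarrow> finite d" using assms by (auto simp: domino_tilings_iff intro: finite_subset)
  ultimately have "card (\<Union>T) = 2 * card T"
    by (simp add: card_Union_disjoint)
  then show ?thesis using assms(1) by (simp add: domino_tilings_iff)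
qed

lemma domino_tilings_empty: "domino_tilings {} = {{}}"
proof -
  have "T = {}" if "\<Union>T = {}" "\<forall>d\<in>T. domino d" for T
    using that not_domino_empty by (metis Union_empty_conv ex_in_conv)
  then show ?thesis unfolding set_eq_iff domino_tilings_iff by auto
qed

lemma domino_tilings_pair:
  assumes "card X = 2"
  shows "domino_tilings X = (if domino X then {{X}} else {})"
proof -
  have "T = {X} \<and> domino X" if T: "T \<in> domino_tilings X" for T
  proof -
    have "card T = 1" using card_tiling_dominoes[OF T] assms by (simp add: card_ge_0_finite)
    then obtain d where "T = {d}" by (auto simp: card_1_singleton_iff)
    then show ?thesis using T by (auto simp: domino_tilings_iff)
  qed
  moreover have "{X} \<in> domino_tilings X" if "domino X" using that by (auto simp: domino_tilings_iff)
  ultimately show ?thesis by auto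
qed

lemma block_eq: "block (x, y) = {(x - 1, y - 1), (x - 1, y), (x, y - 1), (x, y)}"
  by (auto simp: block_def)

lemma card_block: "card (block b) = 4" and finite_block: "finite (block b)"
  by (cases b; simp add: block_eq)+

lemma block_dominoes:
  "domino {(x - 1, y), (x, y)}" "domino {(x, y - 1), (x, y)}"
proof -
  have "horizontal_domino {(x - 1, y), (x, y)}" unfolding horizontal_domino_def
    by (rule exI[of _ "x - 1"], rule exI[of _ y]) simp
  then show "domino {(x - 1, y), (x, y)}" by (simp add: domino_def)
  have "vertical_domino {(x, y - 1), (x, y)}" unfolding vertical_domino_def
    by (rule exI[of _ x], rule exI[of _ "y - 1"]) simp
  then show "domino {(x, y - 1), (x, y)}" by (simp add: domino_def)
qed

lemma domino_in_block:
  assumes "domino d" "d \<subseteq> block (x, y)"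
  shows "d \<in> {{(x - 1, y - 1), (x, y - 1)}, {(x - 1, y), (x, y)},
    {(x - 1, y - 1), (x - 1, y)}, {(x, y - 1), (x, y)}}"
proof -
  consider a b' where "d = {(a, b'), (a + 1, b')}" | a b' where "d = {(a, b'), (a, b' + 1)}"
    using assms(1) unfolding domino_def horizontal_domino_def vertical_domino_def by blast
  then show ?thesis
  proof cases
    case 1
    then have "a = x - 1" "b' = y - 1 \<or> b' = y" using assms(2) by (auto simp: block_def)
    then show ?thesis using 1 by auto
  next
    case 2
    then have "b' = y - 1" "a = x - 1 \<or> a = x" using assms(2) by (auto simp: block_def)
    then show ?thesis using 2 by auto
  qed
qed


text \<open>The dominoes through two opposite corner cells are distinct. If one were horizontal and
  the other vertical, they would overlap; so they are parallel and fill the block.\<close>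

lemma domino_tilings_block: "card (domino_tilings (block b)) = 2"
proof -
  obtain x y where b: "b = (x, y)" by (cases b)
  let ?h = "{(x - 1, y - 1), (x, y - 1)}" and ?h' = "{(x - 1, y), (x, y)}"
  let ?v = "{(x - 1, y - 1), (x - 1, y)}" and ?v' = "{(x, y - 1), (x, y)}"
  have dom: "domino ?h" "domino ?h'" "domino ?v" "domino ?v'"
    by (rule block_dominoes)+
  define H V where "H = {?h, ?h'}" and "V = {?v, ?v'}"
  have "T = H \<or> T = V" if T: "T \<in> domino_tilings (block b)" for T
  proof -
    note disj = domino_tiling_unique[OF T]
    have sub: "d \<in> {?h, ?h', ?v, ?v'}" if "d \<in> T" for d
    proof (rule domino_in_block)
      show "domino d" using domino_tiling_domino[OF T that] .
      show "d \<subseteq> block (x, y)" using domino_tiling_Union[OF T] that b by auto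
    qed
    have cover: "\<exists>d\<in>T. c \<in> d" if "c \<in> block b" for c
      using domino_tiling_Union[OF T] that by auto
    obtain d d' where d: "d \<in> T" "(x - 1, y - 1) \<in> d" and d': "d' \<in> T" "(x, y) \<in> d'"
      using cover[of "(x - 1, y - 1)"] cover[of "(x, y)"] by (auto simp: b block_eq)
    have dd: "d = ?h \<or> d = ?v" "d' = ?h' \<or> d' = ?v'" using sub[of d] sub[of d'] d d' by auto
    have "(x - 1, y - 1) \<notin> d'" using dd(2) by auto
    then have "d \<noteq> d'" using d(2) by metis
    then have "\<not> (d = ?h \<and> d' = ?v')" "\<not> (d = ?v \<and> d' = ?h')"
      using disj[OF d(1) d'(1), of "(x, y - 1)"] disj[OF d(1) d'(1), of "(x - 1, y)"] by auto
    then have dd: "d = ?h \<and> d' = ?h' \<or> d = ?v \<and> d' = ?v'" using dd by blast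
    have "e = d \<or> e = d'" if "e \<in> T" for e
    proof -
      have "\<exists>c. c \<in> e \<and> (c \<in> d \<or> c \<in> d')" using sub[OF that] dd
        by (elim disjE conjE insertE emptyE) (simp_all, blast+)
      then show ?thesis using disj[OF that] d(1) d'(1) by blast
    qed
    then have "T = {d, d'}" using d d' by blast
    then show ?thesis using dd unfolding H_def V_def by (elim disjE conjE) simp_all
  qed
  moreover have "H \<in> domino_tilings (block b)" unfolding H_def
    by (rule domino_tilingI) (use dom in \<open>auto simp: b block_eq\<close>)
  moreover have "V \<in> domino_tilings (block b)" unfolding V_def
    by (rule domino_tilingI) (use dom in \<open>auto simp: b block_eq\<close>)
  ultimately have "domino_tilings (block b) = {H, V}" by blast
  moreover have "H \<noteq> V" by (simp add: H_def V_def doubleton_eq_iff)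
  ultimately show ?thesis by simp
qed

lemma domino_block_compl:
  assumes "domino X" "X \<subseteq> block b"
  shows "domino (block b - X)"
proof -
  obtain x y where b: "b = (x, y)" by (cases b)
  let ?h = "{(x - 1, y - 1), (x, y - 1)}" and ?h' = "{(x - 1, y), (x, y)}"
  let ?v = "{(x - 1, y - 1), (x - 1, y)}" and ?v' = "{(x, y - 1), (x, y)}"
  have dom: "domino ?h" "domino ?h'" "domino ?v" "domino ?v'"
    by (rule block_dominoes)+
  have compl: "block b - ?h = ?h'" "block b - ?h' = ?h" "block b - ?v = ?v'" "block b - ?v' = ?v"
    unfolding b block_eq by auto
  have "X \<in> {?h, ?h', ?v, ?v'}" using assms unfolding b by (rule domino_in_block)
  then show ?thesis using dom compl by (elim insertE emptyE) simp_all
qed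

text \<open>Squared so that no exponent is halved.\<close>

lemma card_domino_tilings_block_compl:
  assumes "X \<subseteq> block b"
  shows "4 * card (domino_tilings X) ^ 2 = 2 ^ card X * card (domino_tilings (block b - X)) ^ 2"
proof -
  have fin: "finite X" using assms finite_block finite_subset by blast
  have card: "card (block b - X) = 4 - card X" "card X \<le> 4"
    using card_Diff_subset[OF fin assms] card_mono[OF finite_block assms] by (auto simp: card_block)
  have odd: "domino_tilings Y = {}" if "odd (card Y)" "finite Y" for Y
    using card_tiling_dominoes[of _ Y] that by fastforce
  \<comment> \<open>For sizes 0, 2 and 4 the factor \<open>2 ^ card X\<close> is 1, 4 and 16, and
    the tiling counts of the part and its complement are 1 and 2, equal, and 2 and 1. Odd sizes give
    0 on both sides.\<close>
  have "card X = 0 \<or> card X = 2 \<or> card X = 4 \<or> odd (card X)" using card(2) by presburger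
  then show ?thesis
  proof (elim disjE)
    assume "card X = 0"
    then have "X = {}" using fin by simp
    then show ?thesis by (simp add: domino_tilings_block domino_tilings_empty)
  next
    assume 2: "card X = 2"
    have "block b - (block b - X) = X" using assms by blast
    then have "domino X \<longleftrightarrow> domino (block b - X)"
      using domino_block_compl[of X b] domino_block_compl[of "block b - X" b] assms by auto
    then show ?thesis
      using 2 card by (simp add: domino_tilings_pair)
  next
    assume 4: "card X = 4"
    then have "X = block b" using card_subset_eq[OF finite_block assms] by (simp add: card_block)
    then show ?thesis by (simp add: domino_tilings_block domino_tilings_empty card_block)
  next
    assume o: "odd (card X)"
    then have "odd (card (block b - X))" using card by simp
    then show ?thesis using odd[OF o fin] odd[of "block b - X"] finite_block by simp
  qed
qed

section \<open>The recursion for the Aztec diamond\<close>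

lemma mem_block: "(a, b) \<in> block (x, y) \<longleftrightarrow> (x = a \<or> x = a + 1) \<and> (y = b \<or> y = b + 1)"
  by (auto simp: block_def)

lemma mem_aztec_diamond_corners:
  "(a, b) \<in> aztec_diamond n \<longleftrightarrow> \<bar>a\<bar> + \<bar>b\<bar> \<le> int n + 1 \<and> \<bar>a + 1\<bar> + \<bar>b\<bar> \<le> int n + 1 \<and>
    \<bar>a\<bar> + \<bar>b + 1\<bar> \<le> int n + 1 \<and> \<bar>a + 1\<bar> + \<bar>b + 1\<bar> \<le> int n + 1"
  by (auto simp: aztec_diamond_def)

section \<open>Geometry of the block centers\<close>

definition centers :: "nat \<Rightarrow> cell set" where
  "centers m = {(x, y). \<bar>x\<bar> + \<bar>y\<bar> \<le> int m \<and> even (x + y + int m)}"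

text \<open>The reflection of the lattice point \<open>(x, y)\<close> in the center of the cell \<open>(a, b)\<close>.\<close>

definition opposite :: "cell \<Rightarrow> cell \<Rightarrow> cell" where
  "opposite = (\<lambda>(a, b) (x, y). (2 * a + 1 - x, 2 * b + 1 - y))"

lemma opposite_opposite [simp]: "opposite c (opposite c b) = b"
  by (cases c; cases b) (simp add: opposite_def)

lemma opposite_neq: "opposite c b \<noteq> b"
proof (cases c; cases b)
  fix x y x' y' assume [simp]: "c = (x, y)" "b = (x', y')"
  have "2 * x + 1 - x' \<noteq> x'" by presburger
  then show ?thesis by (simp add: opposite_def)
qed

lemma mem_block_opposite: "c \<in> block (opposite c b) \<longleftrightarrow> c \<in> block b"
  by (cases c; cases b) (auto simp: opposite_def mem_block)

text \<open>On the boundary \<open>\<bar>x\<bar> + \<bar>y\<bar> = m + 1\<close> the parity is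
  wrong, so the bound may be relaxed by one.\<close>

lemma centers_iff_even:
  assumes "\<bar>x\<bar> + \<bar>y\<bar> \<le> int m + 1"
  shows "(x, y) \<in> centers m \<longleftrightarrow> even (x + y + int m)"
proof -
  have "\<bar>x\<bar> + \<bar>y\<bar> \<noteq> int m + 1" if "even (x + y + int m)"
  proof
    assume *: "\<bar>x\<bar> + \<bar>y\<bar> = int m + 1"
    have "even (\<bar>x\<bar> + \<bar>y\<bar> + int m)" using that by simp
    then show False unfolding * by simp
  qed
  then show ?thesis using assms by (fastforce simp: centers_def)
qed

lemma block_subset_aztec:
  assumes "b \<in> centers m" "c \<in> block b"
  shows "c \<in> aztec_diamond (Suc m)"
  using assms by (cases b; cases c) (auto simp: centers_def mem_block mem_aztec_diamond_corners)

text \<open>The corner \<open>b\<close> of \<open>c\<close> has norm at most \<open>m\<close> and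
  its two neighbouring corners at most \<open>m + 1\<close>, so the opposite corner alone decides
  membership in the smaller diamond. Its parity rules out the norm \<open>m + 1\<close>.\<close>

lemma opposite_in_centers:
  assumes "b \<in> centers m" "c \<in> block b"
  shows "opposite c b \<in> centers m \<longleftrightarrow> c \<in> aztec_diamond m"
proof -
  obtain x y a a' where [simp]: "b = (x, y)" "c = (a, a')" by (cases b; cases c)
  have par: "even (x + y + int m)" and le: "\<bar>x\<bar> + \<bar>y\<bar> \<le> int m" using assms by (auto simp: centers_def)
  have xy: "x = a \<or> x = a + 1" "y = a' \<or> y = a' + 1" using assms by (auto simp: mem_block)
  let ?x = "2 * a + 1 - x" and ?y = "2 * a' + 1 - y"
  have par': "even (?x + ?y + int m)" using par by presburger
  have "(?x, ?y) \<in> centers m \<longleftrightarrow> \<bar>?x\<bar> + \<bar>?y\<bar> \<le> int m + 1"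
    using centers_iff_even[of ?x ?y m] par' by (auto simp: centers_def)
  also have "\<dots> \<longleftrightarrow> c \<in> aztec_diamond m"
    using xy le by (elim disjE) (auto simp: mem_aztec_diamond_corners)
  finally show ?thesis by (simp add: opposite_def)
qed

text \<open>The blocks containing a cell are centered at its four corners, and parity selects one
  diagonal pair of them.\<close>

lemma mem_block_center_cases:
  assumes "b \<in> centers m" "b' \<in> centers m" "c \<in> block b" "c \<in> block b'"
  shows "b' = b \<or> b' = opposite c b"
proof -
  obtain x y a a' x' y' where [simp]: "b = (x, y)" "c = (a, a')" "b' = (x', y')"
    by (cases b; cases c; cases b')
  have par: "even (x + y + int m)" "even (x' + y' + int m)" using assms by (auto simp: centers_def)
  have xy: "x = a \<or> x = a + 1" "y = a' \<or> y = a' + 1" "x' = a \<or> x' = a + 1" "y' = a' \<or> y' = a' + 1"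
    using assms by (auto simp: mem_block)
  have "x' = x \<longleftrightarrow> y' = y" using xy par by (elim disjE; presburger)
  then have "x' = x \<and> y' = y \<or> x' = 2 * a + 1 - x \<and> y' = 2 * a' + 1 - y"
    using xy(1-4) by linarith
  then show ?thesis by (simp add: opposite_def)
qed

lemma block_center_exists:
  assumes "c \<in> aztec_diamond (Suc m)"
  shows "\<exists>b\<in>centers m. c \<in> block b"
proof -
  obtain a a' where [simp]: "c = (a, a')" by (cases c)
  \<comment> \<open>\<open>?f\<close> gives the coordinates of the corner nearest to the origin,
    \<open>?g\<close> the other choice. The nearest corner has norm at most \<open>m\<close>; if its
    parity is wrong, moving along one side corrects it.\<close>
  let ?f = "\<lambda>a :: int. if a \<ge> 0 then a else a + 1" and ?g = "\<lambda>a :: int. if a \<ge> 0 then a + 1 else a"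
  have le: "\<bar>?f a\<bar> + \<bar>?f a'\<bar> \<le> int m" "\<bar>?g a\<bar> + \<bar>?f a'\<bar> \<le> int m + 1"
    using assms by (auto simp: mem_aztec_diamond_corners)
  show ?thesis
  proof (cases "even (?f a + ?f a' + int m)")
    case True
    then have "(?f a, ?f a') \<in> centers m" using le by (simp add: centers_def)
    moreover have "c \<in> block (?f a, ?f a')" by (simp add: mem_block)
    ultimately show ?thesis by blast
  next
    case False
    then have even: "even (?g a + ?f a' + int m)" by (auto split: if_splits)
    then have "(?g a, ?f a') \<in> centers m" using centers_iff_even[OF le(2)] by blast
    moreover have "c \<in> block (?g a, ?f a')" by (simp add: mem_block)
    ultimately show ?thesis by blast
  qed
qed

text \<open>The two blocks containing a domino are centered at the ends of the edge between its
  cells. Both ends have norm at most \<open>m + 1\<close>, and their parities differ.\<close>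

lemma domino_block_unique:
  assumes "domino d" "d \<subseteq> aztec_diamond (Suc m)"
  shows "\<exists>!b. b \<in> centers m \<and> d \<subseteq> block b"
proof -
  consider x y where "d = {(x, y), (x + 1, y)}" | x y where "d = {(x, y), (x, y + 1)}"
    using assms(1) unfolding domino_def horizontal_domino_def vertical_domino_def by blast
  then show ?thesis
  proof cases
    case 1
    have sub: "d \<subseteq> block b \<longleftrightarrow> b = (x + 1, y) \<or> b = (x + 1, y + 1)" for b
      unfolding 1 by (cases b) (auto simp: mem_block)
    have "(x, y) \<in> aztec_diamond (Suc m)" "(x + 1, y) \<in> aztec_diamond (Suc m)" using assms 1 by auto
    then have "\<bar>x + 1\<bar> + \<bar>y\<bar> \<le> int m + 1" "\<bar>x + 1\<bar> + \<bar>y + 1\<bar> \<le> int m + 1"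
      unfolding mem_aztec_diamond_corners by linarith+
    then have "(x + 1, y) \<in> centers m \<longleftrightarrow> even (x + 1 + y + int m)"
      "(x + 1, y + 1) \<in> centers m \<longleftrightarrow> odd (x + 1 + y + int m)"
      by (auto simp: centers_iff_even)
    then show ?thesis unfolding sub by metis
  next
    case 2
    have sub: "d \<subseteq> block b \<longleftrightarrow> b = (x, y + 1) \<or> b = (x + 1, y + 1)" for b
      unfolding 2 by (cases b) (auto simp: mem_block)
    have "(x, y) \<in> aztec_diamond (Suc m)" "(x, y + 1) \<in> aztec_diamond (Suc m)" using assms 2 by auto
    then have "\<bar>x\<bar> + \<bar>y + 1\<bar> \<le> int m + 1" "\<bar>x + 1\<bar> + \<bar>y + 1\<bar> \<le> int m + 1"
      unfolding mem_aztec_diamond_corners by linarith+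
    then have "(x, y + 1) \<in> centers m \<longleftrightarrow> even (x + 1 + y + int m)"
      "(x + 1, y + 1) \<in> centers m \<longleftrightarrow> odd (x + 1 + y + int m)"
      by (auto simp: centers_iff_even)
    then show ?thesis unfolding sub by metis
  qed
qed

lemma card_centers: "card (centers m) = (m + 1) ^ 2"
proof -
  \<comment> \<open>Rotated coordinates \<open>i = (x + y + m) / 2\<close> and
    \<open>j = (x - y + m) / 2\<close> turn the centers into a square grid.\<close>
  let ?f = "\<lambda>(i, j). (int i + int j - int m, int i - int j)"
  have "centers m = ?f ` ({..m} \<times> {..m})"
  proof (intro equalityI subsetI)
    fix p assume "p \<in> centers m"
    then obtain x y where p: "p = (x, y)" "\<bar>x\<bar> + \<bar>y\<bar> \<le> int m" "even (x + y + int m)"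
      by (auto simp: centers_def)
    then obtain i where i: "x + y + int m = 2 * i" by (elim evenE)
    define j where "j = i - y"
    have "x = i + j - int m" "y = i - j" "0 \<le> i" "i \<le> int m" "0 \<le> j" "j \<le> int m"
      using i p(2) unfolding j_def by linarith+
    then have "p = ?f (nat i, nat j)" "(nat i, nat j) \<in> {..m} \<times> {..m}" using p(1) by auto
    then show "p \<in> ?f ` ({..m} \<times> {..m})" by blast
  qed (auto simp: centers_def)
  moreover have "inj_on ?f ({..m} \<times> {..m})" by (auto simp: inj_on_def)
  ultimately show ?thesis by (simp add: card_image power2_eq_square)
qed

lemma finite_centers: "finite (centers m)"
  using card_centers[of m] card_ge_0_finite[of "centers m"] by simp

text \<open>An assignment of the cells of the larger diamond to blocks restricts to the smaller diamond
  by sending each cell to the other one of its two blocks, so that the cells assigned to a block are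
  complemented within the block; the cells outside the smaller diamond lie in a single block.\<close>

lemma card_tilings_aztec_Suc:
  "card (domino_tilings (aztec_diamond (Suc m))) =
    2 ^ Suc m * card (domino_tilings (aztec_diamond m))"
proof -
  let ?B = "centers m" and ?R = "aztec_diamond (Suc m)" and ?R' = "aztec_diamond m"
  let ?S = "\<lambda>R. \<Pi>\<^sub>E c\<in>R. {b \<in> ?B. c \<in> block b}"
  let ?X = "\<lambda>\<sigma> b. {c \<in> ?R. \<sigma> c = b}"
  let ?t = "\<lambda>X. card (domino_tilings X)"
  have sub: "?R' \<subseteq> ?R"
    by (auto simp: mem_aztec_diamond_corners)
  have cnt: "?t R = (\<Sum>\<sigma>\<in>?S R. \<Prod>b\<in>?B. ?t {c \<in> R. \<sigma> c = b})" if "R \<subseteq> ?R" for R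
    using that finite_subset[OF that finite_aztec_diamond] finite_centers domino_block_unique
    by (intro card_domino_tilings_blocks) auto
  define \<phi> where "\<phi> = (\<lambda>\<sigma> :: cell \<Rightarrow> cell. \<lambda>c\<in>?R'. opposite c (\<sigma> c))"
  have mem: "\<sigma> c \<in> ?B" "c \<in> block (\<sigma> c)" if "\<sigma> \<in> ?S R" "c \<in> R" for \<sigma> c R
    using PiE_mem[OF that] by auto
  have only: "b' = b" if "c \<in> ?R" "c \<notin> ?R'" "b \<in> ?B" "b' \<in> ?B" "c \<in> block b" "c \<in> block b'" for c b b'
    using mem_block_center_cases[of b m b' c] opposite_in_centers[of b m c] that by auto
  have \<phi>: "\<phi> \<sigma> \<in> ?S ?R'" if \<sigma>: "\<sigma> \<in> ?S ?R" for \<sigma>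
  proof (rule PiE_I)
    fix c assume c: "c \<in> ?R'"
    then have "\<sigma> c \<in> ?B" "c \<in> block (\<sigma> c)" using mem[OF \<sigma>, of c] sub by auto
    then show "\<phi> \<sigma> c \<in> {b \<in> ?B. c \<in> block b}"
      using c opposite_in_centers[of "\<sigma> c" m c] by (simp add: \<phi>_def mem_block_opposite)
  qed (simp add: \<phi>_def)
  have "inj_on \<phi> (?S ?R)"
  proof (rule inj_onI)
    fix \<sigma> \<sigma>' assume \<sigma>: "\<sigma> \<in> ?S ?R" "\<sigma>' \<in> ?S ?R" and eq: "\<phi> \<sigma> = \<phi> \<sigma>'"
    show "\<sigma> = \<sigma>'"
    proof (rule PiE_ext[OF \<sigma>])
      fix c assume c: "c \<in> ?R"
      show "\<sigma> c = \<sigma>' c"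
      proof (cases "c \<in> ?R'")
        case True
        then have "opposite c (\<sigma> c) = opposite c (\<sigma>' c)" using fun_cong[OF eq, of c] by (simp add: \<phi>_def)
        then show ?thesis by (metis opposite_opposite)
      next
        case False
        then show ?thesis using only[OF c False] mem[OF \<sigma>(1) c] mem[OF \<sigma>(2) c] by blast
      qed
    qed
  qed
  moreover have "\<tau> \<in> \<phi> ` ?S ?R" if \<tau>: "\<tau> \<in> ?S ?R'" for \<tau>
  proof
    \<comment> \<open>By \<open>only\<close>, the choice \<open>SOME\<close> outside the smaller
      diamond has a single candidate.\<close>
    define \<sigma> where "\<sigma> = (\<lambda>c\<in>?R. if c \<in> ?R' then opposite c (\<tau> c) else SOME b. b \<in> ?B \<and> c \<in> block b)"
    show "\<tau> = \<phi> \<sigma>"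
    proof (rule extensionalityI[of _ ?R'])
      show "\<tau> \<in> extensional ?R'" using \<tau> by (auto simp: PiE_def)
      show "\<phi> \<sigma> \<in> extensional ?R'" by (simp add: \<phi>_def)
      fix c assume "c \<in> ?R'"
      then show "\<tau> c = \<phi> \<sigma> c" using sub by (auto simp: \<phi>_def \<sigma>_def)
    qed
    show "\<sigma> \<in> ?S ?R"
    proof (rule PiE_I)
      fix c assume c: "c \<in> ?R"
      show "\<sigma> c \<in> {b \<in> ?B. c \<in> block b}"
      proof (cases "c \<in> ?R'")
        case True
        then show ?thesis
          using c mem[OF \<tau> True] opposite_in_centers[of "\<tau> c" m c] by (simp add: \<sigma>_def mem_block_opposite)
      next
        case False
        have "\<exists>b. b \<in> ?B \<and> c \<in> block b" using block_center_exists[OF c] by blast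
        from someI_ex[OF this] show ?thesis using c False by (simp add: \<sigma>_def)
      qed
    qed (simp add: \<sigma>_def)
  qed
  ultimately have bij: "bij_betw \<phi> (?S ?R) (?S ?R')" using \<phi> unfolding bij_betw_def by blast
  \<comment> \<open>A cell of \<open>block b\<close> not assigned to \<open>b\<close> has
    \<open>b\<close> as its other center, which forces it into the smaller diamond.\<close>
  have fiber: "{c \<in> ?R'. \<phi> \<sigma> c = b} = block b - ?X \<sigma> b" if \<sigma>: "\<sigma> \<in> ?S ?R" and b: "b \<in> ?B" for \<sigma> b
  proof (intro equalityI subsetI)
    fix c assume "c \<in> {c \<in> ?R'. \<phi> \<sigma> c = b}"
    then have c: "c \<in> ?R'" "opposite c (\<sigma> c) = b" by (auto simp: \<phi>_def)
    then have "c \<in> block b" using mem[OF \<sigma>, of c] sub mem_block_opposite[of c "\<sigma> c"] by auto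
    moreover have "\<sigma> c \<noteq> b" using c opposite_neq by metis
    ultimately show "c \<in> block b - ?X \<sigma> b" by simp
  next
    fix c assume "c \<in> block b - ?X \<sigma> b"
    then have c: "c \<in> block b" "c \<in> ?R" "\<sigma> c \<noteq> b" using block_subset_aztec[OF b] by auto
    then have "c \<in> ?R'" using only[OF c(2) _ b] mem[OF \<sigma> c(2)] by blast
    moreover have "b = opposite c (\<sigma> c)"
      using mem_block_center_cases[of "\<sigma> c" m b c] mem[OF \<sigma> c(2)] b c by auto
    ultimately show "c \<in> {c \<in> ?R'. \<phi> \<sigma> c = b}" by (simp add: \<phi>_def)
  qed
  have weight: "(\<Prod>b\<in>?B. ?t (?X \<sigma> b)) = 2 ^ Suc m * (\<Prod>b\<in>?B. ?t (block b - ?X \<sigma> b))"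
    (is "?P = _ * ?Q") if \<sigma>: "\<sigma> \<in> ?S ?R" for \<sigma>
  proof -
    have "(\<Sum>b\<in>?B. card (?X \<sigma> b)) = card ?R"
      using sum.group[of ?R ?B \<sigma> "\<lambda>_. 1 :: nat"] mem[OF \<sigma>]
      by (auto simp: finite_aztec_diamond finite_centers image_subset_iff)
    \<comment> \<open>The size \<open>2 (m + 1) (m + 2)\<close> is split so that
      \<open>(m + 1)^2\<close> matches the factors 4 of the blocks, one per center.\<close>
    then have sum: "(\<Sum>b\<in>?B. card (?X \<sigma> b)) = 2 * ((m + 1) ^ 2 + Suc m)"
      by (simp add: card_aztec_diamond power2_eq_square algebra_simps)
    have "(\<Prod>b\<in>?B. 4 * ?t (?X \<sigma> b) ^ 2) =
        (\<Prod>b\<in>?B. 2 ^ card (?X \<sigma> b) * ?t (block b - ?X \<sigma> b) ^ 2)"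
    proof (rule prod.cong)
      fix b assume "b \<in> ?B"
      have "?X \<sigma> b \<subseteq> block b" using mem[OF \<sigma>] by auto
      then show "4 * ?t (?X \<sigma> b) ^ 2 = 2 ^ card (?X \<sigma> b) * ?t (block b - ?X \<sigma> b) ^ 2"
        by (rule card_domino_tilings_block_compl)
    qed simp
    also have "\<dots> = 2 ^ (2 * ((m + 1) ^ 2 + Suc m)) * ?Q ^ 2"
      unfolding prod.distrib prod_power_distrib power_sum[symmetric] sum ..
    also have "(\<Prod>b\<in>?B. 4 * ?t (?X \<sigma> b) ^ 2) = 4 ^ ((m + 1) ^ 2) * ?P ^ 2"
      unfolding prod.distrib prod_power_distrib by (simp add: card_centers)
    also have "(4 :: nat) ^ ((m + 1) ^ 2) = 2 ^ (2 * (m + 1) ^ 2)" by (simp add: power_mult)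
    \<comment> \<open>Both sides are now squares of natural numbers, so the roots may be
      compared.\<close>
    finally have "(2 ^ ((m + 1) ^ 2) * ?P) ^ 2 = (2 ^ ((m + 1) ^ 2 + Suc m) * ?Q) ^ 2"
      by (simp only: power_mult_distrib power_mult[symmetric] mult.commute)
    then have "2 ^ ((m + 1) ^ 2) * ?P = 2 ^ ((m + 1) ^ 2 + Suc m) * ?Q"
      by (simp only: power2_eq_iff_nonneg zero_le)
    then show ?thesis by (simp add: power_add)
  qed
  have "?t ?R' = (\<Sum>\<sigma>\<in>?S ?R. \<Prod>b\<in>?B. ?t {c \<in> ?R'. \<phi> \<sigma> c = b})"
    using cnt[OF sub] sum.reindex_bij_betw[OF bij, symmetric] by simp
  also have "\<dots> = (\<Sum>\<sigma>\<in>?S ?R. \<Prod>b\<in>?B. ?t (block b - ?X \<sigma> b))"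
    by (intro sum.cong prod.cong refl) (simp only: fiber)
  finally have "2 ^ Suc m * ?t ?R' = (\<Sum>\<sigma>\<in>?S ?R. 2 ^ Suc m * (\<Prod>b\<in>?B. ?t (block b - ?X \<sigma> b)))"
    by (simp only: sum_distrib_left)
  also have "\<dots> = (\<Sum>\<sigma>\<in>?S ?R. \<Prod>b\<in>?B. ?t (?X \<sigma> b))"
    by (rule sum.cong) (simp_all only: weight)
  also have "\<dots> = ?t ?R" using cnt[of ?R] by simp
  finally show ?thesis by simp
qed

section \<open>The hamburger matrix of the Aztec diamond\<close>

text \<open>The bottom half is the image of the top half under the rotation by \<open>\<pi>\<close>: the sign
  \<open>\<epsilon>\<close> is \<open>1\<close> for the top and \<open>- 1\<close> for the bottom, where rows are read from east to west.\<close>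

definition half_point :: "real \<Rightarrow> nat \<Rightarrow> nat \<times> nat \<Rightarrow> real \<times> real" where
  "half_point \<epsilon> n = (\<lambda>(h, i). (\<epsilon> * (2 * real i + real h - real n + 1), \<epsilon> * (real h + 1 / 2)))"

lemma half_point_eq_iff:
  assumes "\<epsilon> = 1 \<or> \<epsilon> = - 1"
  shows "half_point \<epsilon> n p = half_point \<epsilon> n q \<longleftrightarrow> p = q"
  using assms by (cases p; cases q) (auto simp: half_point_def)

lemma aztec_verts_upper: "{(x, y) \<in> aztec_verts n. y > 0} = half_point 1 n ` {(h, i). h + i < n}"
proof (intro equalityI subsetI)
  fix p assume "p \<in> {(x, y) \<in> aztec_verts n. y > 0}"
  then obtain a b where p: "p = (real_of_int a + 1, real_of_int b + 1 / 2)" "real_of_int b + 1 / 2 > 0"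
      and ab: "- aztec_row n b \<le> a" "a < aztec_row n b" "even (a + aztec_row n b)"
    unfolding aztec_verts_alt by auto
  have b: "b \<ge> 0" using p(2) by linarith
  then have row: "aztec_row n b = int n - b" by (simp add: aztec_row_def)
  obtain i where i: "a + (int n - b) = 2 * i" using ab(3) unfolding row by (elim evenE)
  have "0 \<le> i" "i + b < int n" using ab i unfolding row by linarith+
  moreover have "real_of_int a = 2 * real_of_int i + real_of_int b - real n"
    using arg_cong[OF i, of real_of_int] by simp
  ultimately have "p = half_point 1 n (nat b, nat i)" "(nat b, nat i) \<in> {(h, i). h + i < n}"
    using b p(1) by (auto simp: half_point_def)
  then show "p \<in> half_point 1 n ` {(h, i). h + i < n}" by blast
next
  fix p assume "p \<in> half_point 1 n ` {(h, i). h + i < n}"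
  then obtain h i where p: "p = half_point 1 n (h, i)" "h + i < n" by auto
  have "p \<in> aztec_verts n"
    unfolding aztec_verts_alt using p
    by (intro CollectI exI[of _ "2 * int i + int h - int n"] exI[of _ "int h"])
      (auto simp: half_point_def aztec_row_def)
  then show "p \<in> {(x, y) \<in> aztec_verts n. y > 0}" using p by (auto simp: half_point_def)
qed

lemma aztec_verts_lower: "{(x, y) \<in> aztec_verts n. y < 0} = half_point (- 1) n ` {(h, i). h + i < n}"
proof (intro equalityI subsetI)
  fix p assume "p \<in> {(x, y) \<in> aztec_verts n. y < 0}"
  then obtain a b where p: "p = (real_of_int a + 1, real_of_int b + 1 / 2)" "real_of_int b + 1 / 2 < 0"
      and ab: "- aztec_row n b \<le> a" "a < aztec_row n b" "even (a + aztec_row n b)"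
    unfolding aztec_verts_alt by auto
  have b: "b < 0" using p(2) by linarith
  then have row: "aztec_row n b = int n + 1 + b" by (simp add: aztec_row_def)
  obtain k where k: "a + (int n + 1 + b) = 2 * k" using ab(3) unfolding row by (elim evenE)
  \<comment> \<open>The row has \<open>n + 1 + b\<close> dominoes, and \<open>k\<close> is the index
    from the west starting at 0; \<open>i\<close> is the same index from the east.\<close>
  define i where "i = int n + b - k"
  have i: "a = int n + b - 1 - 2 * i" using k unfolding i_def by simp
  have "0 \<le> i" "i - b - 1 < int n" using ab i k unfolding row i_def by linarith+
  moreover have "real_of_int a = real n + real_of_int b - 1 - 2 * real_of_int i"
    using arg_cong[OF i, of real_of_int] by simp
  ultimately have "p = half_point (- 1) n (nat (- b - 1), nat i)"
      "(nat (- b - 1), nat i) \<in> {(h, i). h + i < n}"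
    using b p(1) by (auto simp: half_point_def)
  then show "p \<in> half_point (- 1) n ` {(h, i). h + i < n}" by blast
next
  fix p assume "p \<in> half_point (- 1) n ` {(h, i). h + i < n}"
  then obtain h i where p: "p = half_point (- 1) n (h, i)" "h + i < n" by auto
  have "p \<in> aztec_verts n"
    unfolding aztec_verts_alt using p
    by (intro CollectI exI[of _ "int n - int h - 2 - 2 * int i"] exI[of _ "- 1 - int h"])
      (auto simp: half_point_def aztec_row_def)
  then show "p \<in> {(x, y) \<in> aztec_verts n. y < 0}" using p by (auto simp: half_point_def)
qed

text \<open>Translates the arcs of either half into lattice steps: a vertex is present exactly when
  \<open>h' + i' < n\<close>, and a down step from height 0 leaves the half.\<close>

lemma half_point_steps:
  assumes \<epsilon>: "\<epsilon> = 1 \<or> \<epsilon> = - 1" and p: "p \<in> {(h, i). h + i < n}" and xy: "half_point \<epsilon> n p = (x, y)"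
  shows "q \<in> half_point \<epsilon> n ` schroeder_steps n p \<longleftrightarrow>
    q \<in> half_point \<epsilon> n ` {(h, i). h + i < n} \<and>
    q \<in> {(x + 2 * \<epsilon>, y), (x + \<epsilon>, y + \<epsilon>), (x + \<epsilon>, y - \<epsilon>)}"
proof -
  obtain h i where hi: "p = (h, i)" by (cases p)
  have "half_point \<epsilon> n (h', i') \<in> {(x + 2 * \<epsilon>, y), (x + \<epsilon>, y + \<epsilon>), (x + \<epsilon>, y - \<epsilon>)} \<longleftrightarrow>
      (h', i') \<in> schroeder_steps n p" if "h' + i' < n" for h' i'
  proof -
    have "half_point \<epsilon> n (h', i') = (x + 2 * \<epsilon>, y) \<longleftrightarrow> h' = h \<and> i' = i + 1"
      "half_point \<epsilon> n (h', i') = (x + \<epsilon>, y + \<epsilon>) \<longleftrightarrow> h' = h + 1 \<and> i' = i"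
      "half_point \<epsilon> n (h', i') = (x + \<epsilon>, y - \<epsilon>) \<longleftrightarrow> h' + 1 = h \<and> i' = i + 1"
      using \<epsilon> xy unfolding hi by (auto simp: half_point_def)
    then show ?thesis using that unfolding hi by (auto simp: schroeder_steps_def split: if_splits)
  qed
  moreover have "schroeder_steps n p \<subseteq> {(h, i). h + i < n}"
    using p unfolding hi by (auto simp: schroeder_steps_def split: if_splits)
  ultimately show ?thesis by (auto simp: image_iff) blast+
qed

section \<open>Path counts in the two halves and the block determinant\<close>

lemma path_count_aztec_upper:
  assumes "i < n" "j < n"
  shows "int (path_count (aztec_upper n) (aztec_v n (i + 1)) (aztec_v n (j + 1))) =
    (if i \<le> j then fps_nth schroeder_fps (j - i) else 0)"
proof -
  let ?V = "{(x, y) \<in> aztec_verts n. y > 0}"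
  \<comment> \<open>The arcs between \<open>aztec_v\<close> and \<open>aztec_w\<close> join points
    of opposite sign of \<open>y\<close>, so they disappear in the half.\<close>
  have arcs: "((x, y), q) \<in> arcs (aztec_upper n) \<longleftrightarrow> (x, y) \<in> ?V \<and> q \<in> ?V \<and>
      q \<in> {(x + 2 * 1, y), (x + 1, y + 1), (x + 1, y - 1)}" for x y q
    by (auto simp: aztec_upper_def aztec_digraph_def aztec_arcs_def aztec_v_def aztec_w_def)
  have v: "aztec_v n (k + 1) = half_point 1 n (0, k)" for k
    by (simp add: aztec_v_def half_point_def)
  have "int (path_count (aztec_upper n) (half_point 1 n (0, i)) (half_point 1 n (0, j))) =
      schroeder_count j (0, i)"
  proof (rule path_count_schroeder)
    show "fin_digraph (aztec_upper n)" by (rule aztec_halves_fin_digraph)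
    show "tail (aztec_upper n) = fst" "head (aztec_upper n) = snd"
      by (simp_all add: aztec_upper_def)
    show "inj_on (half_point 1 n) {(h, i). h + i < n}" by (simp add: inj_on_def half_point_eq_iff)
    show "verts (aztec_upper n) = half_point 1 n ` {(h, i). h + i < n}"
      by (simp add: aztec_upper_def aztec_verts_upper)
    fix p q assume p: "p \<in> {(h, i). h + i < n}"
    obtain x y where xy: "half_point 1 n p = (x, y)" by (cases "half_point 1 n p")
    then have "(x, y) \<in> ?V" unfolding aztec_verts_upper using p by (metis imageI)
    then have "(half_point 1 n p, q) \<in> arcs (aztec_upper n) \<longleftrightarrow>
        q \<in> ?V \<and> q \<in> {(x + 2 * 1, y), (x + 1, y + 1), (x + 1, y - 1)}"
      unfolding xy using arcs[of x y q] by (simp only: simp_thms)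
    also have "\<dots> \<longleftrightarrow> q \<in> half_point 1 n ` schroeder_steps n p"
      unfolding aztec_verts_upper by (rule half_point_steps[OF _ p xy, symmetric]) simp
    finally show "(half_point 1 n p, q) \<in> arcs (aztec_upper n) \<longleftrightarrow>
      q \<in> half_point 1 n ` schroeder_steps n p" .
  qed (use assms in auto)
  then show ?thesis by (simp add: v[simplified] schroeder_count_def)
qed

text \<open>Reading from the east turns the index \<open>k\<close> into \<open>n - 1 - k\<close>, so
  the roles of \<open>i\<close> and \<open>j\<close> are exchanged and the matrix becomes the
  transpose of the upper one.\<close>

lemma path_count_aztec_lower:
  assumes "i < n" "j < n"
  shows "int (path_count (aztec_lower n) (aztec_w n (n + i + 1)) (aztec_w n (n + j + 1))) =
    (if j \<le> i then fps_nth schroeder_fps (i - j) else 0)"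
proof -
  let ?V = "{(x, y) \<in> aztec_verts n. y < 0}"
  have arcs: "((x, y), q) \<in> arcs (aztec_lower n) \<longleftrightarrow> (x, y) \<in> ?V \<and> q \<in> ?V \<and>
      q \<in> {(x + 2 * - 1, y), (x + - 1, y + - 1), (x + - 1, y - - 1)}" for x y q
    by (auto simp: aztec_lower_def aztec_digraph_def aztec_arcs_def aztec_v_def aztec_w_def)
  have w: "aztec_w n (n + k + 1) = half_point (- 1) n (0, n - 1 - k)" if "k < n" for k
    using that by (simp add: aztec_w_def half_point_def of_nat_diff)
  have "int (path_count (aztec_lower n) (half_point (- 1) n (0, n - 1 - i)) (half_point (- 1) n (0, n - 1 - j))) =
      schroeder_count (n - 1 - j) (0, n - 1 - i)"
  proof (rule path_count_schroeder)
    show "fin_digraph (aztec_lower n)" by (rule aztec_halves_fin_digraph)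
    show "tail (aztec_lower n) = fst" "head (aztec_lower n) = snd"
      by (simp_all add: aztec_lower_def)
    show "inj_on (half_point (- 1) n) {(h, i). h + i < n}" by (simp add: inj_on_def half_point_eq_iff)
    show "verts (aztec_lower n) = half_point (- 1) n ` {(h, i). h + i < n}"
      by (simp add: aztec_lower_def aztec_verts_lower)
    fix p q assume p: "p \<in> {(h, i). h + i < n}"
    obtain x y where xy: "half_point (- 1) n p = (x, y)" by (cases "half_point (- 1) n p")
    then have "(x, y) \<in> ?V" unfolding aztec_verts_lower using p by (metis imageI)
    then have "(half_point (- 1) n p, q) \<in> arcs (aztec_lower n) \<longleftrightarrow>
        q \<in> ?V \<and> q \<in> {(x + 2 * - 1, y), (x + - 1, y + - 1), (x + - 1, y - - 1)}"
      unfolding xy using arcs[of x y q] by (simp only: simp_thms)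
    also have "\<dots> \<longleftrightarrow> q \<in> half_point (- 1) n ` schroeder_steps n p"
      unfolding aztec_verts_lower by (rule half_point_steps[OF _ p xy, symmetric]) simp
    finally show "(half_point (- 1) n p, q) \<in> arcs (aztec_lower n) \<longleftrightarrow>
      q \<in> half_point (- 1) n ` schroeder_steps n p" .
  qed (use assms in auto)
  then show ?thesis
    unfolding w[OF assms(1)] w[OF assms(2)] using assms by (auto simp: schroeder_count_def)
qed

text \<open>The lower left block is minus the identity and commutes with the lower right one, so the
  block determinant is that of \<open>A A^T + I\<close>.\<close>

lemma det_aztec_hamburger_matrix:
  "det (aztec_hamburger_matrix n) = det (1\<^sub>m n + toeplitz_gram n schroeder_fps)"
proof -
  let ?A = "upper_toeplitz n schroeder_fps"
  have A: "mat n n (\<lambda>(i, j). int (path_count (aztec_upper n) (aztec_v n (i + 1)) (aztec_v n (j + 1)))) = ?A"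
    by (rule eq_matI) (simp_all only: index_mat prod.case path_count_aztec_upper upper_toeplitz_index
        upper_toeplitz_dim dim_row_mat dim_col_mat)
  have B: "mat n n (\<lambda>(i, j). int (path_count (aztec_lower n) (aztec_w n (n + i + 1)) (aztec_w n (n + j + 1)))) =
      transpose_mat ?A"
    by (rule eq_matI) (simp_all only: index_mat prod.case path_count_aztec_lower upper_toeplitz_index
        upper_toeplitz_dim index_transpose_mat dim_row_mat dim_col_mat)
  have "aztec_hamburger_matrix n = four_block_mat ?A (1\<^sub>m n) (- 1\<^sub>m n) (transpose_mat ?A)"
    unfolding aztec_hamburger_matrix_def hamburger_matrix_def A B ..
  also have "det \<dots> = det (?A * transpose_mat ?A - 1\<^sub>m n * (- 1\<^sub>m n))"
    by (rule det_four_block_mat[of _ n]) auto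
  also have "?A * transpose_mat ?A - 1\<^sub>m n * (- 1\<^sub>m n) = 1\<^sub>m n + toeplitz_gram n schroeder_fps"
    by (rule eq_matI) (auto simp: toeplitz_gram_def)
  finally show ?thesis .
qed

lemma card_tilings_aztec_eq_det:
  "int (card (domino_tilings (aztec_diamond n))) = det (1\<^sub>m n + toeplitz_gram n schroeder_fps)"
proof (induction n)
  \<comment> \<open>The empty region has one tiling, the empty one, and the determinant of a matrix
    of size 0 is 1.\<close>
  case 0
  have "aztec_diamond 0 = {}" using card_aztec_diamond[of 0] finite_aztec_diamond[of 0] by simp
  then show ?case by (simp add: domino_tilings_empty)
next
  case (Suc n)
  then show ?case by (simp add: card_tilings_aztec_Suc det_one_plus_toeplitz_gram_Suc del: power_Suc)
qed

theorem corollary5p2: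
  fixes n :: nat
  assumes "n \<ge> 1"
  shows "int (card (domino_tilings (aztec_diamond n))) = det (aztec_hamburger_matrix n)"
  by (simp only: card_tilings_aztec_eq_det det_aztec_hamburger_matrix)

end
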